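(* Let $\mathcal{G}^s=(\mathcal{V}^s,\mathcal{E}^s)$ be a summary causal graph (SCG) associated with a dynamic structural causal model with true (unknown) probability distribution $P$, satisfying causal sufficiency and consistency throughout time. Let $X,Y\in\mathcal{V}^s$ be distinct and let $\gamma\ge 0$. The total effect $P(y_t \mid do(x_{t-\gamma}))$ is identifiable (in $\mathcal{G}^s$) if either $X \notin \mathrm{Anc}(Y,\mathcal{G}^s)$, or $X \in \mathrm{Anc}(Y,\mathcal{G}^s)$ and none of the following holds: 1. $\gamma \neq 0$ and $Cycles^>(X, \mathcal{G}^s\backslash \{Y\}) \neq \emptyset$; or 2. there exists a $\sigma$-active backdoor path $\pi^s = \langle V^1=X, \cdots, V^n=Y\rangle$ from $X$ to $Y$ in $\mathcal{G}^s$ such that $\{V^2, \cdots, V^{n-1}\}\subseteq \mathrm{Desc}(X, \mathcal{G}^s)$ and one of the following holds: (a) $n > 2$, i.e. $\{V^2, \cdots, V^{n-1}\}\neq\emptyset$; or (b) $n=2$ and $\gamma\neq 1$; or (c) $n=2$, $\gamma = 1$ and $Cycles(Y, \mathcal{G}^s)\backslash\{X\leftrightarrows Y\} \neq \emptyset$.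
   Context: Let $\mathcal{V}$ be a finite set of $p$ observed time series and $\mathcal{V}^f=\{\mathcal{V}_{t-\ell}\mid \ell\in\mathbb{Z}\}$ the set of their temporal instances ($X_{t-\ell}$ is the variable of series $X$ at time $t-\ell$). **Full-time causal graph (FTCG).** The series are generated by an unknown dynamic structural causal model (DSCM; a structural causal model in the sense of Pearl over $\mathcal{V}^f$). Its FTCG $\mathcal{G}^f=(\mathcal{V}^f,\mathcal{E}^f)$ has an edge $X_{t-\gamma}\to Y_t$ iff $X$ directly causes $Y$ at time $t$ with time lag $\gamma$, where $\gamma>0$ if $X=Y$ and $\gamma\ge 0$ if $X\neq Y$. FTCGs are acyclic (instantaneous edges, of lag $0$, are allowed). The DSCM also defines a joint distribution $P$ over $\mathcal{V}^f$, assumed positive, which decomposes recursively along the FTCG as in Bayesian networks. **Causal sufficiency.** There is no hidden common cause between any two observed variables. **Consistency throughout time.** All causal relationships in the FTCG remain constant in direction and magnitude throughout time (so the edge set is invariant under time shift); edges have lag at most a fixed maximal lag $\gamma_{\max}$. **Summary causal graph (SCG).** The SCG $\mathcal{G}^s=(\mathcal{V}^s,\mathcal{E}^s)$ derived from $\mathcal{G}^f$ has $\mathcal{V}^s=\mathcal{V}$, and $X\to Y\in\mathcal{E}^s$ iff there is at least one lag $0\le\ell\le\gamma_{\max}$ with $X_{t-\ell}\to Y_t\in\mathcal{E}^f$. An SCG is a directed graph that may contain directed cycles and self-loops. $X\leftrightarrows Y$ (or $X\rightleftarrows Y$) means that both $X\to Y$ and $Y\to X$ are in $\mathcal{E}^s$.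 **Candidate FTCGs.** $\mathcal{C}(\mathcal{G}^s)$ is the set of all FTCGs (acyclic, satisfying causal sufficiency and consistency throughout time, with maximal lag $\gamma_{\max}$) from which $\mathcal{G}^s$ can be derived. **Total effect and identifiability.** $P(y_t\mid do(x_{t-\gamma}))$ denotes $P(Y_t=y_t\mid do(X_{t-\gamma}=x_{t-\gamma}))$, the distribution of $Y_t$ under Pearl's intervention on the single variable $X_{t-\gamma}$. It is identifiable in $\mathcal{G}^s$ iff it can be rewritten with a do-free formula (an expression in the observational distribution $P$ only) that is valid for any FTCG in $\mathcal{C}(\mathcal{G}^s)$. **Graph notions in an SCG.** $\mathrm{Anc}(V,\mathcal{G})$ and $\mathrm{Desc}(V,\mathcal{G})$ are the ancestors and descendants of $V$ (via directed paths; $V$ is its own ancestor and descendant). $\mathcal{G}\backslash\{Y\}$ is $\mathcal{G}$ with vertex $Y$ and its incident edges removed. A path is a sequence of distinct vertices in which successive vertices are adjacent; each successive pair is linked by $\to$, $\leftarrow$ or $\leftrightarrows$ (the latter when both directed edges are present). A directed cycle is formed by a directed path from $V$ to $W$ together with a directed path from $W$ to $V$; a self-loop is also a directed cycle. $Cycles(V,\mathcal{G})$ is the set of all directed cycles containing $V$, and $Cycles^>(V,\mathcal{G})$ the subset of those with at least two different vertices (i.e. excluding self-loops). $Cycles(Y,\mathcal{G}^s)\backslash\{X\leftrightarrows Y\}$ is the set of directed cycles containing $Y$ other than the 2-cycle between $X$ and $Y$. A backdoor path between $X$ and $Y$ in $\mathcal{G}^s$ is a path between $X$ and $Y$ that starts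 with $X\leftarrow$ or $X\leftrightarrows$. A path in $\mathcal{G}^s$ is $\sigma$-blocked (by the empty set) if there is a vertex $Z$ such that $\to Z\leftarrow$ is on the path (the patterns $\leftrightarrows Z\leftarrow$, $\to Z\leftrightarrows$, $\leftrightarrows Z\leftrightarrows$ do not count); otherwise it is $\sigma$-active. In particular $X\leftrightarrows Y$ and $X\leftarrow Y$ are the only $\sigma$-active backdoor paths with $n=2$ vertices. *)

theory Defs
  imports "HOL-Probability.Probability"
begin

section \<open>Graph notions in a summary causal graph\<close>

text \<open>
  The observed series are the elements of a finite type. A summary causal graph is its edge
  relation: \<^term>\<open>(A, B) \<in> E\<close> stands for the edge from A to B. Directed cycles and self-loops
  are allowed.
\<close>

type_synonym 'v scg = "('v \<times> 'v) set"

definition Anc :: "'v \<Rightarrow> 'v scg \<Rightarrow> 'v set" where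
  "Anc V E = {W. (W, V) \<in> E\<^sup>*}"

definition Desc :: "'v \<Rightarrow> 'v scg \<Rightarrow> 'v set" where
  "Desc V E = {W. (V, W) \<in> E\<^sup>*}"

definition remove_vertex :: "'v scg \<Rightarrow> 'v \<Rightarrow> 'v scg" where
  "remove_vertex E Y = {(A, B) \<in> E. A \<noteq> Y \<and> B \<noteq> Y}"

definition directed_path :: "'v scg \<Rightarrow> 'v \<Rightarrow> 'v list \<Rightarrow> 'v \<Rightarrow> bool" where
  "directed_path E A p B \<longleftrightarrow>
     p \<noteq> [] \<and> hd p = A \<and> last p = B \<and> distinct p \<and> successively (\<lambda>C D. (C, D) \<in> E) p"

text \<open>
  A directed cycle is written as the closed list of the vertices visited, the base point occurring
  both first and last. The same cycle may thus be written from several base points.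
\<close>

definition directed_cycle :: "'v scg \<Rightarrow> 'v list \<Rightarrow> bool" where
  "directed_cycle E c \<longleftrightarrow>
     (\<exists>V W p q. V \<noteq> W \<and> directed_path E V p W \<and> directed_path E W q V \<and> c = p @ tl q) \<or>
     (\<exists>V. (V, V) \<in> E \<and> c = [V, V])"

definition Cycles :: "'v \<Rightarrow> 'v scg \<Rightarrow> 'v list set" where
  "Cycles V E = {c. directed_cycle E c \<and> V \<in> set c}"

definition Cycles_gt :: "'v \<Rightarrow> 'v scg \<Rightarrow> 'v list set" where
  "Cycles_gt V E = {c \<in> Cycles V E. 2 \<le> card (set c)}"

text \<open>The two ways of writing the 2-cycle between X and Y.\<close>

definition two_cycle :: "'v \<Rightarrow> 'v \<Rightarrow> 'v list set" where
  "two_cycle X Y = {[X, Y, X], [Y, X, Y]}"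

definition scg_path :: "'v scg \<Rightarrow> 'v \<Rightarrow> 'v list \<Rightarrow> 'v \<Rightarrow> bool" where
  "scg_path E A p B \<longleftrightarrow>
     p \<noteq> [] \<and> hd p = A \<and> last p = B \<and> distinct p \<and>
     successively (\<lambda>C D. (C, D) \<in> E \<or> (D, C) \<in> E) p"

definition backdoor_path :: "'v scg \<Rightarrow> 'v \<Rightarrow> 'v list \<Rightarrow> 'v \<Rightarrow> bool" where
  "backdoor_path E X p Y \<longleftrightarrow> scg_path E X p Y \<and> 2 \<le> length p \<and> (p ! 1, X) \<in> E"

text \<open>
  A link of a path is a bidirected pair as soon as both directed edges are present, so an arrow on
  a path requires the converse edge to be absent.
\<close>

definition arrow :: "'v scg \<Rightarrow> 'v \<Rightarrow> 'v \<Rightarrow> bool" where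
  "arrow E A B \<longleftrightarrow> (A, B) \<in> E \<and> (B, A) \<notin> E"

definition sigma_blocked :: "'v scg \<Rightarrow> 'v list \<Rightarrow> bool" where
  "sigma_blocked E p \<longleftrightarrow>
     (\<exists>i. 0 < i \<and> i + 1 < length p \<and>
        arrow E (p ! (i - 1)) (p ! i) \<and> arrow E (p ! (i + 1)) (p ! i))"

definition sigma_active :: "'v scg \<Rightarrow> 'v list \<Rightarrow> bool" where
  "sigma_active E p \<longleftrightarrow> \<not> sigma_blocked E p"

definition inner_vertices :: "'v list \<Rightarrow> 'v set" where
  "inner_vertices p = set (butlast (tl p))"


section \<open>Full-time causal graphs\<close>

text \<open>The vertex \<^term>\<open>(V, t)\<close> is the instance of the series V at time t.\<close>

type_synonym 'v instance_at = "'v \<times> int"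
type_synonym 'v ftcg = "('v instance_at \<times> 'v instance_at) set"

definition time_consistent :: "'v ftcg \<Rightarrow> bool" where
  "time_consistent F \<longleftrightarrow>
     (\<forall>A B s t d. ((A, s), (B, t)) \<in> F \<longleftrightarrow> ((A, s + d), (B, t + d)) \<in> F)"

definition lags_within :: "nat \<Rightarrow> 'v ftcg \<Rightarrow> bool" where
  "lags_within \<gamma>max F \<longleftrightarrow> (\<forall>A B s t. ((A, s), (B, t)) \<in> F \<longrightarrow> s \<le> t \<and> t - s \<le> int \<gamma>max)"

definition scg_of :: "nat \<Rightarrow> 'v ftcg \<Rightarrow> 'v scg" where
  "scg_of \<gamma>max F = {(A, B). \<exists>t l. l \<le> \<gamma>max \<and> ((A, t - int l), (B, t)) \<in> F}"

text \<open>
  Causal sufficiency means that there are no hidden common causes, that is, no bidirected edges, so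
  it is built into the type of graphs. Acyclicity excludes self-causation at lag 0.
\<close>

definition candidate_ftcgs :: "nat \<Rightarrow> 'v scg \<Rightarrow> 'v ftcg set" where
  "candidate_ftcgs \<gamma>max E =
     {F. acyclic F \<and> time_consistent F \<and> lags_within \<gamma>max F \<and> scg_of \<gamma>max F = E}"


section \<open>Dynamic structural causal models\<close>

text \<open>
  \<open>mech D V h u\<close> is the structural function of the series V: \<open>h (W, l)\<close> is the value of W, l time
  steps ago, and u is the exogenous noise of V. There is one function per series, used at all
  times. \<open>law D\<close> is the joint distribution of the endogenous and the exogenous trajectories; it is
  part of the data since, with an infinite past, the structural equations and the noise alone need
  not determine a unique process. Real-valued noise with an arbitrary law encodes any standard
  Borel noise.
\<close>

record ('v, 'a) dscm =
  mech :: "'v \<Rightarrow> ('v \<times> nat \<Rightarrow> 'a) \<Rightarrow> real \<Rightarrow> 'a"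
  law :: "(('v instance_at \<Rightarrow> 'a) \<times> ('v instance_at \<Rightarrow> real)) measure"

definition history :: "('v instance_at \<Rightarrow> 'a) \<Rightarrow> int \<Rightarrow> 'v \<times> nat \<Rightarrow> 'a" where
  "history z t = (\<lambda>(W, l). z (W, t - int l))"

definition direct_cause :: "('v, 'a) dscm \<Rightarrow> 'v \<Rightarrow> nat \<Rightarrow> 'v \<Rightarrow> bool" where
  "direct_cause D A l B \<longleftrightarrow> (\<exists>h a u. mech D B (h((A, l) := a)) u \<noteq> mech D B h u)"

definition ftcg_of :: "('v, 'a) dscm \<Rightarrow> 'v ftcg" where
  "ftcg_of D = {((A, t - int l), (B, t)) | A l B t. direct_cause D A l B}"

definition mechanisms_wf :: "nat \<Rightarrow> ('v, 'a::topological_space) dscm \<Rightarrow> bool" where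
  "mechanisms_wf \<gamma>max D \<longleftrightarrow>
     (\<forall>V. (\<lambda>(h, u). mech D V h u) \<in> borel_measurable (PiM UNIV (\<lambda>_. borel) \<Otimes>\<^sub>M borel)) \<and>
     (\<forall>V h h' u. (\<forall>W l. l \<le> \<gamma>max \<longrightarrow> h (W, l) = h' (W, l)) \<longrightarrow> mech D V h u = mech D V h' u)"

definition solves_equations :: "('v, 'a) dscm \<Rightarrow> bool" where
  "solves_equations D \<longleftrightarrow>
     (AE (z, u) in law D. \<forall>V t. z (V, t) = mech D V (history z t) (u (V, t)))"

definition independent_noises :: "('v, 'a) dscm \<Rightarrow> bool" where
  "independent_noises D \<longleftrightarrow>
     prob_space.indep_vars (law D) (\<lambda>_. borel) (\<lambda>i (z, u). u i) UNIV"

definition stationary_noises :: "('v, 'a) dscm \<Rightarrow> bool" where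
  "stationary_noises D \<longleftrightarrow>
     (\<forall>V t t'. distr (law D) borel (\<lambda>(z, u). u (V, t)) = distr (law D) borel (\<lambda>(z, u). u (V, t')))"

text \<open>
  The noises from time t on are independent of the process before t. This is automatic when the
  recursion has a starting point. Together with the independence of the noises it yields the
  recursive decomposition of the observational distribution along the full-time causal graph.
\<close>

definition nonanticipative :: "('v, 'a::topological_space) dscm \<Rightarrow> bool" where
  "nonanticipative D \<longleftrightarrow>
     (\<forall>t. let past = {i. snd i < t}; future = {i. t \<le> snd i};
              Past = PiM past (\<lambda>_. borel :: 'a measure);
              Future = PiM future (\<lambda>_. borel :: real measure)
          in distr (law D) (Past \<Otimes>\<^sub>M Future) (\<lambda>(z, u). (restrict z past, restrict u future))
             = distr (law D) Past (\<lambda>(z, u). restrict z past)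
               \<Otimes>\<^sub>M distr (law D) Future (\<lambda>(z, u). restrict u future))"

definition observational :: "('v, 'a::topological_space) dscm \<Rightarrow> ('v instance_at \<Rightarrow> 'a) measure" where
  "observational D = distr (law D) (PiM UNIV (\<lambda>_. borel)) fst"

text \<open>
  \<open>\<mu> V\<close> is the reference measure of the values of V: a counting measure on the possible values of a
  discrete series, Lebesgue measure for a continuous one. Positivity means that all
  finite-dimensional distributions have a positive density.
\<close>

definition positive_distribution ::
    "('v \<Rightarrow> 'a measure) \<Rightarrow> ('v instance_at \<Rightarrow> 'a::topological_space) measure \<Rightarrow> bool" where
  "positive_distribution \<mu> P \<longleftrightarrow>
     (\<forall>S. finite S \<longrightarrow>
        (\<exists>p \<in> borel_measurable (PiM S (\<lambda>(V, t). \<mu> V)). (\<forall>z. 0 < (p z :: real)) \<and>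
           distr P (PiM S (\<lambda>(V, t). \<mu> V)) (\<lambda>z. restrict z S)
           = density (PiM S (\<lambda>(V, t). \<mu> V)) (\<lambda>z. ennreal (p z))))"

definition is_dscm :: "nat \<Rightarrow> ('v \<Rightarrow> 'a measure) \<Rightarrow> ('v, 'a::topological_space) dscm \<Rightarrow> bool" where
  "is_dscm \<gamma>max \<mu> D \<longleftrightarrow>
     prob_space (law D) \<and>
     sets (law D) = sets (PiM UNIV (\<lambda>_. borel) \<Otimes>\<^sub>M PiM UNIV (\<lambda>_. borel)) \<and>
     mechanisms_wf \<gamma>max D \<and> acyclic (ftcg_of D) \<and> solves_equations D \<and>
     independent_noises D \<and> stationary_noises D \<and> nonanticipative D \<and>
     positive_distribution \<mu> (observational D)"


section \<open>Interventions and identifiability\<close>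

text \<open>
  The trajectory under do(X at time s := x), for the unit with factual trajectory z and noise u: the
  equation of X at time s is replaced by the constant x, all others are kept. Times before s are
  causally unaffected; this is imposed since, with an infinite past, the equations alone need not
  enforce it.
\<close>

definition do_solution ::
    "('v, 'a) dscm \<Rightarrow> 'v \<Rightarrow> int \<Rightarrow> 'a \<Rightarrow>
     ('v instance_at \<Rightarrow> 'a) \<times> ('v instance_at \<Rightarrow> real) \<Rightarrow> ('v instance_at \<Rightarrow> 'a) \<Rightarrow> bool" where
  "do_solution D X s x = (\<lambda>(z, u) z'.
     z' (X, s) = x \<and>
     (\<forall>V r. r < s \<longrightarrow> z' (V, r) = z (V, r)) \<and>
     (\<forall>V r. s \<le> r \<and> (V, r) \<noteq> (X, s) \<longrightarrow> z' (V, r) = mech D V (history z' r) (u (V, r))))"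

definition do_trajectory ::
    "('v, 'a) dscm \<Rightarrow> 'v \<Rightarrow> int \<Rightarrow> 'a \<Rightarrow>
     ('v instance_at \<Rightarrow> 'a) \<times> ('v instance_at \<Rightarrow> real) \<Rightarrow> 'v instance_at \<Rightarrow> 'a" where
  "do_trajectory D X s x \<omega> = (THE z'. do_solution D X s x \<omega> z')"

lemma mech_cong_direct_causes:
  fixes D :: "('v::finite, 'a::topological_space) dscm"
  assumes wf: "mechanisms_wf \<gamma>max D"
    and eq: "\<And>A l. direct_cause D A l B \<Longrightarrow> h (A, l) = h' (A, l)"
  shows "mech D B h u = mech D B h' u"
proof -
  let ?L = "UNIV \<times> {..\<gamma>max} :: ('v \<times> nat) set"
  have "mech D B (\<lambda>i. if i \<in> S then h' i else h i) u = mech D B h u" if "finite S" for S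
    using that
  proof (induction S)
    case empty
    then show ?case by simp
  next
    case (insert i S)
    obtain A l where i: "i = (A, l)" by (cases i)
    let ?g = "\<lambda>i. if i \<in> S then h' i else h i"
    have "(\<lambda>j. if j \<in> insert i S then h' j else h j) = ?g((A, l) := h' (A, l))"
      by (auto simp: i fun_eq_iff)
    moreover have "mech D B (?g((A, l) := h' (A, l))) u = mech D B ?g u"
    proof (cases "direct_cause D A l B")
      case True
      then have "?g((A, l) := h' (A, l)) = ?g"
        using eq[OF True] by (auto simp: fun_eq_iff)
      then show ?thesis by simp
    next
      case False
      then show ?thesis unfolding direct_cause_def by blast
    qed
    ultimately show ?case using insert.IH by simp
  qed
  from this[of ?L] have "mech D B (\<lambda>i. if i \<in> ?L then h' i else h i) u = mech D B h u"
    by simp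
  moreover have "mech D B (\<lambda>i. if i \<in> ?L then h' i else h i) u = mech D B h' u"
    using wf unfolding mechanisms_wf_def by simp
  ultimately show ?thesis by simp
qed

lemma wf_ftcg_from:
  fixes D :: "('v::finite, 'a) dscm"
  assumes "acyclic (ftcg_of D)"
  shows "wf {(a, b) \<in> ftcg_of D. s \<le> snd b}"
proof (rule wfI_min)
  let ?R = "{(a, b) \<in> ftcg_of D. s \<le> snd b}"
  fix b :: "'v instance_at" and Q assume b: "b \<in> Q"
  show "\<exists>m\<in>Q. \<forall>y. (y, m) \<in> ?R \<longrightarrow> y \<notin> Q"
  proof (cases "\<exists>a\<in>Q. snd a < s")
    case True
    then show ?thesis by force
  next
    case False
    let ?A = "UNIV \<times> {s..snd b} :: 'v instance_at set"
    let ?R' = "?R \<inter> ?A \<times> ?A"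
    have "finite ?R'" by (intro finite_Int disjI2) simp
    moreover have "acyclic ?R'" using assms by (rule acyclic_subset) auto
    ultimately have wf: "wf ?R'" by (rule finite_acyclic_wf)
    have "b \<in> Q \<inter> ?A" using b False by (cases b) force
    with wf obtain m where m: "m \<in> Q \<inter> ?A" "\<And>y. (y, m) \<in> ?R' \<Longrightarrow> y \<notin> Q \<inter> ?A"
      by (rule wfE_min) blast
    have "y \<notin> Q" if "(y, m) \<in> ?R" for y
    proof
      assume "y \<in> Q"
      moreover have "snd y \<le> snd m" using that by (auto simp: ftcg_of_def)
      ultimately have "y \<in> Q \<inter> ?A" using m(1) False by (cases y) force
      then show False using m that by blast
    qed
    then show ?thesis using m(1) by blast
  qed
qed

lemma do_solution_ex1:
  fixes D :: "('v::finite, 'a::topological_space) dscm"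
  assumes wf: "mechanisms_wf \<gamma>max D" and ac: "acyclic (ftcg_of D)"
  shows "\<exists>!z'. do_solution D X s x \<omega> z'"
proof -
  obtain z u where \<omega>: "\<omega> = (z, u)" by (cases \<omega>)
  let ?R = "{(a, b) \<in> ftcg_of D. s \<le> snd b}"
  have wfR: "wf ?R" using ac by (rule wf_ftcg_from)
  define F where "F = (\<lambda>g i. if i = (X, s) then x else if snd i < s then z i
    else mech D (fst i) (history g (snd i)) (u i))"
  have cong: "F g i = F g' i" if "\<And>j. (j, i) \<in> ?R \<Longrightarrow> g j = g' j" for g g' i
  proof (cases "i = (X, s) \<or> snd i < s")
    case True
    then show ?thesis by (auto simp: F_def)
  next
    case False
    have "mech D (fst i) (history g (snd i)) (u i) = mech D (fst i) (history g' (snd i)) (u i)"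
    proof (rule mech_cong_direct_causes[OF wf])
      fix A l assume "direct_cause D A l (fst i)"
      then have "((A, snd i - int l), i) \<in> ?R"
        using False by (cases i) (auto simp: ftcg_of_def)
      then show "history g (snd i) (A, l) = history g' (snd i) (A, l)"
        using that by (simp add: history_def)
    qed
    then show ?thesis using False by (simp add: F_def)
  qed
  have sol: "do_solution D X s x \<omega> z' \<longleftrightarrow> (\<forall>i. z' i = F z' i)" for z'
    unfolding do_solution_def \<omega> F_def by (auto simp: not_less)
  show ?thesis
  proof (rule ex_ex1I)
    have "wfrec ?R F i = F (wfrec ?R F) i" for i
      unfolding wfrec[OF wfR, of F i] by (rule cong) (simp add: cut_apply)
    then show "\<exists>z'. do_solution D X s x \<omega> z'" unfolding sol by blast
  next
    fix z1 z2 assume "do_solution D X s x \<omega> z1" "do_solution D X s x \<omega> z2"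
    then have eq: "\<And>i. z1 i = F z1 i" "\<And>i. z2 i = F z2 i" unfolding sol by auto
    have "z1 i = z2 i" for i
      using wfR
    proof (induction i)
      case (less i)
      then have "F z1 i = F z2 i" by (intro cong) auto
      then show ?case using eq by metis
    qed
    then show "z1 = z2" by blast
  qed
qed

text \<open>The distribution of Y at time t under do(X at time s := x).\<close>

definition total_effect ::
    "('v, 'a::topological_space) dscm \<Rightarrow> 'v \<Rightarrow> int \<Rightarrow> 'a \<Rightarrow> 'v \<Rightarrow> int \<Rightarrow> 'a measure" where
  "total_effect D X s x Y t = distr (law D) borel (\<lambda>\<omega>. do_trajectory D X s x \<omega> (Y, t))"

text \<open>
  A do-free formula is a functional of the observational distribution alone, the same for all
  candidate graphs. Conditioning on X = x only makes sense up to null sets of values x; for a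
  discrete series this covers every possible value.
\<close>

definition identifiable ::
    "nat \<Rightarrow> ('v \<Rightarrow> 'a::topological_space measure) \<Rightarrow> 'v scg \<Rightarrow> 'v \<Rightarrow> 'v \<Rightarrow> nat \<Rightarrow> int \<Rightarrow> bool" where
  "identifiable \<gamma>max \<mu> E X Y \<gamma> t \<longleftrightarrow>
     (\<exists>\<Phi> :: ('v instance_at \<Rightarrow> 'a) measure \<Rightarrow> 'a \<Rightarrow> 'a measure.
        \<forall>D :: ('v, 'a) dscm. is_dscm \<gamma>max \<mu> D \<and> ftcg_of D \<in> candidate_ftcgs \<gamma>max E \<longrightarrow>
          (AE x in \<mu> X. total_effect D X (t - int \<gamma>) x Y t = \<Phi> (observational D) x))"

end

theory Submission
  imports Defs
begin

text \<open>
Write \<open>s = t - \<gamma>\<close> for the time of the treatment. One adjustment set works in all cases: the observed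
past of s, within the maximal lag, together with the instances at time s of the nondescendants of X in
the summary graph (\<open>adjustment_set\<close>). It depends on the summary graph only and none of its members
is affected by the treatment, so what has to be excluded is a confounder that it misses. Such a
confounder is an instance at time s of a descendant Z of X that is an ancestor of the treatment and,
along a path avoiding the treatment, of the outcome. The graphical condition rules this out in every
candidate full-time graph (\<open>no_unadjusted_confounder_in_slice\<close>). If X is not an ancestor of Y,
no descendant of X reaches Y. Otherwise Z lies on a cycle with X. For \<open>\<gamma> = 0\<close>, Z is a common
cause of X and Y in the summary graph; for \<open>\<gamma> > 0\<close>, the cycle either stays away from Y, which is
forbidden, or makes Y an ancestor of X. Both remaining cases give an active backdoor path through
descendants of X (\<open>common_cause_imp_active_backdoor_path\<close>). The only such path that is tolerated is
the direct link at \<open>\<gamma> = 1\<close>; then Z could only be Y itself, and it would need instantaneous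
effects in both directions between X and Y, which acyclicity excludes.

The step from the graph to probabilities works with the structural equations instead of
d-separation. Solving them shows that the outcome is a function of treatment, adjustment variables and
the noises of a set A of vertices, with the same function in the factual and in the intervened
world, whereas treatment and adjustment variables are functions of the past and the noises of a set
B (\<open>do_trajectory_eq_response\<close>, \<open>outcome_eq_response\<close>, \<open>treatment_eq_clamped\<close>). A common element of A
and B would be an unadjusted confounder, so A and B are disjoint and the noises in A are independent
of treatment and adjustment variables. This independence is ignorability, and the backdoor
formula follows by Fubini (\<open>backdoor_adjustment\<close>).

The formula involves conditional probabilities, which the observational law determines only almost
everywhere. Positivity of the density makes the exceptional set negligible for almost every treatment
value (\<open>positive_distribution_AE_insert\<close>), and a countable family of events determines a law on a
Polish space; so models with the same observational law have the same effect almost everywhere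
(\<open>total_effects_agree\<close>), which is identifiability.
\<close>

section \<open>Paths, cycles and common causes in a summary graph\<close>

lemma successively_imp_rtrancl:
  assumes "successively (\<lambda>C D. (C, D) \<in> R) p" "p \<noteq> []"
  shows "(hd p, last p) \<in> R\<^sup>*"
  using assms
proof (induction p)
  case (Cons A p)
  then show ?case by (cases p) (auto intro: converse_rtrancl_into_rtrancl)
qed simp

lemma directed_path_imp_rtrancl:
  assumes p: "directed_path R A p B" and v: "v \<in> set p"
  shows "(A, v) \<in> R\<^sup>*" "(v, B) \<in> R\<^sup>*"
proof -
  obtain p1 p2 where eq: "p = (p1 @ [v]) @ p2"
    using v by (metis append.assoc append_Cons append_Nil split_list)
  have "successively (\<lambda>C D. (C, D) \<in> R) (p1 @ [v])"
    using p unfolding eq directed_path_def by (simp only: successively_append_iff)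
  then show "(A, v) \<in> R\<^sup>*"
    using successively_imp_rtrancl[of R "p1 @ [v]"] p unfolding eq directed_path_def
    by (cases p1) auto
  have "successively (\<lambda>C D. (C, D) \<in> R) (v # p2)"
    using p unfolding eq directed_path_def by (simp add: successively_append_iff)
  then show "(v, B) \<in> R\<^sup>*"
    using successively_imp_rtrancl[of R "v # p2"] p unfolding eq directed_path_def by auto
qed

text \<open>
The induction extends a simple path at its start; when the new vertex already lies on the path,
the suffix starting there is taken instead.
\<close>

lemma rtrancl_imp_directed_path:
  assumes "(A, B) \<in> R\<^sup>*"
  shows "\<exists>p. directed_path R A p B"
  using assms
proof (induction rule: converse_rtrancl_induct)
  case base
  then show ?case by (intro exI[of _ "[B]"]) (simp add: directed_path_def)
next
  case (step C A)
  then obtain p where p: "directed_path R A p B" by blast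
  show ?case
  proof (cases "C \<in> set p")
    case True
    then obtain p1 p2 where eq: "p = p1 @ C # p2" by (meson split_list)
    have "directed_path R C (C # p2) B"
      using p unfolding eq directed_path_def by (auto simp: successively_append_iff)
    then show ?thesis by blast
  next
    case False
    have "directed_path R C (C # p) B"
      using p False step unfolding directed_path_def by (auto simp: successively_Cons)
    then show ?thesis by blast
  qed
qed

text \<open>
Two distinct strongly connected vertices always give a directed cycle, because a directed cycle
is a pair of simple paths there and back that may share inner vertices.
\<close>

lemma strongly_connected_imp_directed_cycle:
  assumes "V \<noteq> W" "(V, W) \<in> R\<^sup>*" "(W, V) \<in> R\<^sup>*"
  shows "\<exists>c. directed_cycle R c \<and> V \<in> set c \<and> W \<in> set c"
proof -
  obtain p q where p: "directed_path R V p W" and q: "directed_path R W q V"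
    using assms rtrancl_imp_directed_path by metis
  have "directed_cycle R (p @ tl q)" using assms(1) p q unfolding directed_cycle_def by blast
  moreover have "V \<in> set p" "W \<in> set p"
    using p unfolding directed_path_def by (metis hd_in_set, metis last_in_set)
  ultimately show ?thesis by auto
qed

lemma rtrancl_avoid_or_through:
  assumes "(A, B) \<in> R\<^sup>*"
  shows "(A, B) \<in> (remove_vertex R Y)\<^sup>* \<or> ((A, Y) \<in> R\<^sup>* \<and> (Y, B) \<in> R\<^sup>*)"
  using assms
proof (induction rule: rtrancl_induct)
  case (step C B)
  show ?case
  proof (cases "C = Y \<or> B = Y")
    case True
    then show ?thesis using step by (auto intro: rtrancl_into_rtrancl)
  next
    case False
    then have "(C, B) \<in> remove_vertex R Y" using step by (simp add: remove_vertex_def)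
    then show ?thesis using step by (meson rtrancl_into_rtrancl)
  qed
qed simp

text \<open>
Take the last vertex of T on a path from Z to X: the rest of the path avoids T. This serves to
glue a path outside T to a path inside T without repeating a vertex.
\<close>

lemma exit_edge:
  assumes "(Z, X) \<in> R\<^sup>*" "Z \<in> T" "X \<notin> T"
  shows "\<exists>a b. (Z, a) \<in> R\<^sup>* \<and> a \<in> T \<and> (a, b) \<in> R \<and> (b, X) \<in> {(c, d) \<in> R. c \<notin> T \<and> d \<notin> T}\<^sup>*"
proof -
  let ?R' = "{(c, d) \<in> R. c \<notin> T \<and> d \<notin> T}"
  have "(Z, X) \<in> ?R'\<^sup>* \<or> (\<exists>a b. (Z, a) \<in> R\<^sup>* \<and> a \<in> T \<and> (a, b) \<in> R \<and> (b, X) \<in> ?R'\<^sup>*)"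
    using assms(1)
  proof (induction rule: converse_rtrancl_induct)
    case (step V V')
    from step.IH show ?case
    proof
      assume V': "(V', X) \<in> ?R'\<^sup>*"
      then have "V' \<notin> T" using assms(3) by (auto elim: converse_rtranclE)
      then show ?thesis
        using step V' by (cases "V \<in> T") (blast, blast intro: converse_rtrancl_into_rtrancl)
    qed (use step in \<open>meson converse_rtrancl_into_rtrancl\<close>)
  qed simp
  moreover have "(Z, X) \<notin> ?R'\<^sup>*" using assms(2,3) by (auto elim: converse_rtranclE)
  ultimately show ?thesis by blast
qed

text \<open>
A common cause Z of X and Y is visible as a backdoor path. Every link of the path from X up
to the branching vertex carries an edge towards X, and every later link an edge towards Y; so no
vertex can be a pure collider and the path is \<open>\<sigma>\<close>-active, whatever converse edges are present.
The case Z = Y is included; the path is then a directed path from Y to X read backwards.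
\<close>

lemma common_cause_imp_active_backdoor_path:
  assumes "Z \<noteq> X" and X: "(Z, X) \<in> E\<^sup>*" and Y: "(Z, Y) \<in> {(a, b) \<in> E. b \<noteq> X}\<^sup>*"
  shows "\<exists>\<pi>. backdoor_path E X \<pi> Y \<and> sigma_active E \<pi> \<and> inner_vertices \<pi> \<subseteq> Desc Z E"
proof -
  let ?RY = "{(a, b) \<in> E. b \<noteq> X}"
  \<comment> \<open>The vertices from which Y can still be reached without X. The backdoor path leaves X
    outside T and enters T only once, at the branching vertex a.\<close>
  define T where "T = {v. v \<noteq> X \<and> (v, Y) \<in> ?RY\<^sup>*}"
  let ?RX = "{(c, d) \<in> E. c \<notin> T \<and> d \<notin> T}"
  have T: "Z \<in> T" "X \<notin> T" using assms unfolding T_def by auto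
  from exit_edge[OF X T] obtain a b
    where ab: "(Z, a) \<in> E\<^sup>*" "a \<in> T" "(a, b) \<in> E" "(b, X) \<in> ?RX\<^sup>*"
    by blast
  have sub: "?RX\<^sup>* \<subseteq> E\<^sup>*" "?RY\<^sup>* \<subseteq> E\<^sup>*" by (intro rtrancl_mono; blast)+
  obtain p where p: "directed_path ?RX b p X"
    using rtrancl_imp_directed_path[OF ab(4)] by blast
  note p_reach = directed_path_imp_rtrancl[OF p]
  have "(a, Y) \<in> ?RY\<^sup>*" using ab(2) unfolding T_def by blast
  from rtrancl_imp_directed_path[OF this] obtain q where q: "directed_path ?RY a q Y" by blast
  note q_reach = directed_path_imp_rtrancl[OF q]
  have pT: "v \<notin> T" if "v \<in> set p" for v
    using p_reach(2)[OF that] T(2) by (auto elim: converse_rtranclE)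
  have qT: "v \<in> T" if "v \<in> set q" for v
  proof -
    have "(a, v) \<in> ?RY\<^sup>*" using q_reach(1)[OF that] .
    then have "v \<noteq> X" using ab(2) unfolding T_def by (auto elim: rtranclE)
    then show ?thesis using q_reach(2)[OF that] unfolding T_def by blast
  qed
  let ?\<pi> = "rev p @ q"
  have ne: "p \<noteq> []" "q \<noteq> []" "hd p = b" "last p = X" "hd q = a" "last q = Y"
    "distinct p" "distinct q"
    using p q unfolding directed_path_def by auto
  have sp: "successively (\<lambda>c d. (c, d) \<in> E) p" and sq: "successively (\<lambda>c d. (c, d) \<in> E) q"
    using p q unfolding directed_path_def by (auto elim: successively_mono)
  have bwd: "(?\<pi> ! Suc i, ?\<pi> ! i) \<in> E" if "i < length p" for i
  proof (cases "Suc i < length p")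
    case True
    have "successively (\<lambda>c d. (d, c) \<in> E) (rev p)" using sp by simp
    then show ?thesis using True by (auto simp: successively_conv_nth nth_append)
  next
    case False
    then have "i = length p - 1" using that by simp
    then show ?thesis using ab(3) ne
      by (simp add: nth_append rev_nth hd_conv_nth)
  qed
  have fwd: "(?\<pi> ! i, ?\<pi> ! Suc i) \<in> E" if "length p \<le> i" "Suc i < length ?\<pi>" for i
    using sq that by (auto simp: successively_conv_nth nth_append Suc_diff_le)
  have "scg_path E X ?\<pi> Y"
    unfolding scg_path_def
  proof (intro conjI)
    show "hd ?\<pi> = X" "last ?\<pi> = Y" using ne by (auto simp: hd_rev)
    show "distinct ?\<pi>" using ne pT qT by auto
    show "successively (\<lambda>C D. (C, D) \<in> E \<or> (D, C) \<in> E) ?\<pi>"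
      unfolding successively_conv_nth using bwd fwd by (meson not_le)
  qed (use ne in simp)
  moreover have "(?\<pi> ! 1, X) \<in> E"
  proof -
    have "?\<pi> ! 0 = X" using ne by (simp add: nth_append rev_nth last_conv_nth)
    then show ?thesis using bwd[of 0] ne by simp
  qed
  moreover have "2 \<le> length ?\<pi>" using ne by (cases p; cases q) auto
  moreover have "sigma_active E ?\<pi>"
    unfolding sigma_active_def sigma_blocked_def arrow_def
  proof clarify
    fix i assume i: "0 < i" "i + 1 < length ?\<pi>"
      "(?\<pi> ! i, ?\<pi> ! (i - 1)) \<notin> E" "(?\<pi> ! i, ?\<pi> ! (i + 1)) \<notin> E"
    then show False using bwd[of "i - 1"] fwd[of i] by (cases "i - 1 < length p") auto
  qed
  moreover have "inner_vertices ?\<pi> \<subseteq> Desc Z E"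
  proof -
    have "(Z, b) \<in> E\<^sup>*" using ab by auto
    then have "set ?\<pi> \<subseteq> Desc Z E"
      using p_reach(1)[THEN subsetD[OF sub(1)]] q_reach(1)[THEN subsetD[OF sub(2)]] ab(1)
      unfolding Desc_def by (auto intro: rtrancl_trans)
    moreover have "inner_vertices ?\<pi> \<subseteq> set ?\<pi>"
      unfolding inner_vertices_def by (cases ?\<pi>) (auto dest: in_set_butlastD)
    ultimately show ?thesis by blast
  qed
  ultimately show ?thesis unfolding backdoor_path_def by blast
qed

section \<open>Confounders of a single time slice\<close>

lemma ftcg_edge_summary:
  assumes "F \<in> candidate_ftcgs \<gamma>max E" "((A, r), (B, r')) \<in> F"
  shows "(A, B) \<in> E" "r \<le> r'" "r' - r \<le> int \<gamma>max"
proof -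
  show le: "r \<le> r'" "r' - r \<le> int \<gamma>max"
    using assms unfolding candidate_ftcgs_def lags_within_def by blast+
  have "((A, r' - int (nat (r' - r))), (B, r')) \<in> F" "nat (r' - r) \<le> \<gamma>max"
    using assms(2) le by auto
  then have "(A, B) \<in> scg_of \<gamma>max F" unfolding scg_of_def by blast
  then show "(A, B) \<in> E" using assms(1) unfolding candidate_ftcgs_def by blast
qed

lemma ftcg_rtrancl_summary:
  assumes F: "F \<in> candidate_ftcgs \<gamma>max E" and "(i, j) \<in> F\<^sup>*"
  shows "(fst i, fst j) \<in> E\<^sup>*" "snd i \<le> snd j"
proof -
  have "(fst i, fst j) \<in> E\<^sup>* \<and> snd i \<le> snd j"
    using assms(2)
  proof (induction rule: rtrancl_induct)
    case (step j k)
    have "((fst j, snd j), (fst k, snd k)) \<in> F" using step(2) by simp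
    from ftcg_edge_summary[OF F this] step.IH show ?case by (auto intro: rtrancl_into_rtrancl)
  qed simp
  then show "(fst i, fst j) \<in> E\<^sup>*" "snd i \<le> snd j" by blast+
qed

lemma ftcg_rtrancl_shift:
  assumes F: "F \<in> candidate_ftcgs \<gamma>max E" and "((A, r), (B, r')) \<in> F\<^sup>*"
  shows "((A, r + d), (B, r' + d)) \<in> F\<^sup>*"
  using assms(2)
proof (induction rule: rtrancl_induct2)
  case (step B r' C r'')
  have "((B, r' + d), (C, r'' + d)) \<in> F"
    using F step(2) unfolding candidate_ftcgs_def time_consistent_def by blast
  then show ?case using step.IH by auto
qed simp

text \<open>
All vertices of an instantaneous path lie in the slice s, so avoiding the single instance of X
at time s amounts to avoiding the whole series X in the summary graph. For paths that leave the
slice this fails, as they may return through later instances of X.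
\<close>

lemma instantaneous_rtrancl_summary_avoiding:
  assumes F: "F \<in> candidate_ftcgs \<gamma>max E"
    and "((Z, s), (Y, s)) \<in> {(a, b) \<in> F. b \<noteq> (X, s)}\<^sup>*"
  shows "(Z, Y) \<in> {(a, b) \<in> E. b \<noteq> X}\<^sup>*"
proof -
  let ?R = "{(a, b) \<in> F. b \<noteq> (X, s)}"
  have "s \<le> snd i \<longrightarrow> (fst i, Y) \<in> {(a, b) \<in> E. b \<noteq> X}\<^sup>*" if "(i, (Y, s)) \<in> ?R\<^sup>*" for i
    using that
  proof (induction rule: converse_rtrancl_induct)
    case (step i j)
    have "(j, (Y, s)) \<in> F\<^sup>*" using step(2) rtrancl_mono[of ?R F] by blast
    then have "snd j \<le> s" using ftcg_rtrancl_summary[OF F] by fastforce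
    moreover have "((fst i, snd i), (fst j, snd j)) \<in> F" using step(1) by auto
    note edge = ftcg_edge_summary[OF F this]
    have "(fst i, fst j) \<in> {(a, b) \<in> E. b \<noteq> X}" if "s \<le> snd i"
      using that \<open>snd j \<le> s\<close> edge step(1) by (cases j) auto
    with edge step.IH show ?case by (auto intro: converse_rtrancl_into_rtrancl)
  qed simp
  from this[OF assms(2)] show ?thesis by simp
qed

definition effect_identification_condition :: "'v scg \<Rightarrow> 'v \<Rightarrow> 'v \<Rightarrow> nat \<Rightarrow> bool" where
  "effect_identification_condition E X Y \<gamma> \<longleftrightarrow>
     X \<notin> Anc Y E \<or>
     (X \<in> Anc Y E \<and>
      \<not> (\<gamma> \<noteq> 0 \<and> Cycles_gt X (remove_vertex E Y) \<noteq> {}) \<and>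
      \<not> (\<exists>\<pi>. backdoor_path E X \<pi> Y \<and> sigma_active E \<pi> \<and>
             inner_vertices \<pi> \<subseteq> Desc X E \<and>
             (length \<pi> > 2 \<or>
              (length \<pi> = 2 \<and> \<gamma> \<noteq> 1) \<or>
              (length \<pi> = 2 \<and> \<gamma> = 1 \<and> Cycles Y E - two_cycle X Y \<noteq> {}))))"

text \<open>
This is where the graphical condition is used. A confounder Z in the slice of the treatment that
is a descendant of X cannot be put into the adjustment set without knowing the full-time graph, since
its instance at time s may come after the treatment; so it must not exist in any candidate graph.

Such a Z is strongly connected to X in the summary graph. If \<open>\<gamma> = 0\<close>, it is a common cause of X and Y
and gives a forbidden backdoor path. If \<open>\<gamma> > 0\<close>, the cycle through X and Z has to pass through Y, so Y is
an ancestor of X and the only backdoor path left is the direct link, with \<open>\<gamma> = 1\<close> and no cycle at Y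
other than the one with X. Then Z = Y, and Y at time \<open>t - 1\<close> can act on Y at time t only through X at
time t followed by an instantaneous effect of X on Y. But Y at time \<open>t - 1\<close> also acts
instantaneously on X, and these two instantaneous effects would make the slice cyclic.
\<close>

lemma no_unadjusted_confounder_in_slice:
  assumes cond: "effect_identification_condition E X Y \<gamma>" and "X \<noteq> Y"
    and F: "F \<in> candidate_ftcgs \<gamma>max E" and s: "t = s + int \<gamma>"
    and Z: "Z \<in> Desc X E" "Z \<noteq> X"
    and ZX: "((Z, s), (X, s)) \<in> F\<^sup>*"
    and ZY: "((Z, s), (Y, t)) \<in> {(a, b) \<in> F. b \<noteq> (X, s)}\<^sup>*"
  shows False
proof -
  have ac: "acyclic F" using F unfolding candidate_ftcgs_def by blast
  have sub: "{(a, b) \<in> F. b \<noteq> (X, s)}\<^sup>* \<subseteq> F\<^sup>*" by (rule rtrancl_mono) blast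
  have X_Z: "(X, Z) \<in> E\<^sup>*" using Z unfolding Desc_def by simp
  have Z_X: "(Z, X) \<in> E\<^sup>*" using ftcg_rtrancl_summary[OF F ZX] by simp
  have Z_Y: "(Z, Y) \<in> E\<^sup>*" using ftcg_rtrancl_summary[OF F subsetD[OF sub ZY]] by simp
  have X_Y: "(X, Y) \<in> E\<^sup>*" using X_Z Z_Y by simp
  have no_cycle: "\<gamma> \<noteq> 0 \<Longrightarrow> Cycles_gt X (remove_vertex E Y) = {}"
    and no_backdoor: "\<And>\<pi>. backdoor_path E X \<pi> Y \<Longrightarrow> sigma_active E \<pi> \<Longrightarrow>
        inner_vertices \<pi> \<subseteq> Desc X E \<Longrightarrow> \<gamma> = 1 \<and> Cycles Y E \<subseteq> two_cycle X Y"
  proof -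
    fix \<pi> assume \<pi>: "backdoor_path E X \<pi> Y" "sigma_active E \<pi>" "inner_vertices \<pi> \<subseteq> Desc X E"
    then have "2 \<le> length \<pi>" unfolding backdoor_path_def by blast
    then show "\<gamma> = 1 \<and> Cycles Y E \<subseteq> two_cycle X Y"
      using cond X_Y \<pi> unfolding effect_identification_condition_def Anc_def
      by (auto simp: le_less)
  qed (use cond X_Y in \<open>auto simp: effect_identification_condition_def Anc_def\<close>)
  have common_cause: "\<gamma> = 1 \<and> Cycles Y E \<subseteq> two_cycle X Y"
    if "V \<in> Desc X E" "V \<noteq> X" "(V, X) \<in> E\<^sup>*" "(V, Y) \<in> {(a, b) \<in> E. b \<noteq> X}\<^sup>*" for V
  proof -
    from common_cause_imp_active_backdoor_path[OF that(2,3,4)]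
    obtain \<pi> where "backdoor_path E X \<pi> Y" "sigma_active E \<pi>" "inner_vertices \<pi> \<subseteq> Desc V E"
      by blast
    moreover have "Desc V E \<subseteq> Desc X E" using that(1) unfolding Desc_def by auto
    ultimately show ?thesis using no_backdoor by blast
  qed
  show False
  proof (cases "\<gamma> = 0")
    case True
    then have "(Z, Y) \<in> {(a, b) \<in> E. b \<noteq> X}\<^sup>*"
      using instantaneous_rtrancl_summary_avoiding[OF F] ZY s by simp
    from common_cause[OF Z Z_X this] True show False by simp
  next
    case False
    have Y_X: "(Y, X) \<in> E\<^sup>*"
    proof (rule ccontr)
      assume no: "(Y, X) \<notin> E\<^sup>*"
      have "(X, Z) \<in> (remove_vertex E Y)\<^sup>*" "(Z, X) \<in> (remove_vertex E Y)\<^sup>*"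
        using rtrancl_avoid_or_through[OF X_Z, of Y] rtrancl_avoid_or_through[OF Z_X, of Y] no Z_X
        by (meson rtrancl_trans)+
      then obtain c where c: "directed_cycle (remove_vertex E Y) c" "X \<in> set c" "Z \<in> set c"
        using strongly_connected_imp_directed_cycle Z(2) by metis
      have "card {X, Z} \<le> card (set c)" using c by (intro card_mono) auto
      then have "c \<in> Cycles_gt X (remove_vertex E Y)"
        using c Z(2) unfolding Cycles_gt_def Cycles_def by simp
      then show False using no_cycle[OF False] by blast
    qed
    have "Y \<in> Desc X E" using X_Y unfolding Desc_def by simp
    from common_cause[OF this assms(2)[symmetric] Y_X]
    have \<gamma>: "\<gamma> = 1" and cyc: "Cycles Y E \<subseteq> two_cycle X Y" by auto
    have scc: "V = X \<or> V = Y" if YV: "(Y, V) \<in> E\<^sup>*" "(V, Y) \<in> E\<^sup>*" for V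
    proof (rule ccontr)
      assume V: "\<not> ?thesis"
      then obtain c where c: "directed_cycle E c" "Y \<in> set c" "V \<in> set c"
        using strongly_connected_imp_directed_cycle[of Y V E] YV by metis
      then have "c \<in> two_cycle X Y" using cyc unfolding Cycles_def by blast
      then show False using c V unfolding two_cycle_def by auto
    qed
    have no_loop: "(Y, Y) \<notin> E"
    proof
      assume "(Y, Y) \<in> E"
      then have "[Y, Y] \<in> Cycles Y E" unfolding Cycles_def directed_cycle_def by simp
      then show False using cyc unfolding two_cycle_def by auto
    qed
    have ZeqY: "Z = Y" using scc[of Z] Z Z_Y rtrancl_trans[OF Y_X X_Z] by blast
    have t: "t = s + 1" using s \<gamma> by simp
    from ZY obtain V r where V: "((Y, s), (V, r)) \<in> F" "(V, r) \<noteq> (X, s)"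
      "((V, r), (Y, t)) \<in> F\<^sup>*"
      unfolding ZeqY using sub t by (cases rule: converse_rtranclE) auto
    have YV: "(Y, V) \<in> E" "s \<le> r" using ftcg_edge_summary[OF F V(1)] by auto
    have "(V, Y) \<in> E\<^sup>*" "r \<le> t" using ftcg_rtrancl_summary[OF F V(3)] by auto
    then have "V = X" using scc[of V] YV no_loop by blast
    then have "r = t" using V(2) YV \<open>r \<le> t\<close> t by auto
    have "((X, t), (Y, t)) \<in> F\<^sup>*" using V(3) \<open>V = X\<close> \<open>r = t\<close> by simp
    moreover have "((Y, t), (X, t)) \<in> F\<^sup>*"
      using ftcg_rtrancl_shift[OF F ZX, of 1] ZeqY t by simp
    ultimately have "(X, t) = (Y, t)" using ac
      by (metis acyclic_impl_antisym_rtrancl antisymD)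
    then show False using assms(2) by simp
  qed
qed

section \<open>Solving the structural equations with clamped values\<close>

text \<open>
The trajectory whose values on K are prescribed by f, all other values following the structural
equations. Clamping the past and one vertex gives an intervention; clamping the past alone recovers
the factual trajectory; clamping also the adjustment variables expresses the outcome through them.
\<close>

definition clamped_solution ::
    "('v, 'a) dscm \<Rightarrow> 'v instance_at set \<Rightarrow> ('v instance_at \<Rightarrow> 'a) \<Rightarrow> ('v instance_at \<Rightarrow> real) \<Rightarrow>
     'v instance_at \<Rightarrow> 'a" where
  "clamped_solution D K f u =
     wfrec {(a, b) \<in> ftcg_of D. b \<notin> K}
       (\<lambda>z i. if i \<in> K then f i else mech D (fst i) (history z (snd i)) (u i))"

locale clamped_model =
  fixes \<gamma>max :: nat and D :: "('v::finite, 'a::topological_space) dscm" and s :: int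
    and K :: "'v instance_at set"
  assumes wf_mech: "mechanisms_wf \<gamma>max D"
    and acyclic_ftcg: "acyclic (ftcg_of D)"
    and past_clamped: "{i. snd i < s} \<subseteq> K"
begin

lemma wf_unclamped: "wf {(a, b) \<in> ftcg_of D. b \<notin> K}"
  by (rule wf_subset[OF wf_ftcg_from[OF acyclic_ftcg, of s]]) (use past_clamped in force)

lemma history_cong_direct_causes:
  assumes "\<And>j. (j, i) \<in> ftcg_of D \<Longrightarrow> z j = z' j"
  shows "mech D (fst i) (history z (snd i)) e = mech D (fst i) (history z' (snd i)) e"
proof (rule mech_cong_direct_causes[OF wf_mech])
  fix A l assume "direct_cause D A l (fst i)"
  then have "((A, snd i - int l), i) \<in> ftcg_of D"
    by (cases i) (auto simp: ftcg_of_def)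
  then show "history z (snd i) (A, l) = history z' (snd i) (A, l)"
    using assms by (simp add: history_def)
qed

text \<open>
A set S that contains the parents of its unclamped members is autonomous: the trajectory on S
depends only on the clamped values and noises in S. Uniqueness of solutions, their locality and the
invariance of nondescendants under an intervention are all instances, with different S.
\<close>

lemma solutions_agree:
  assumes parents: "\<And>i j. i \<in> S \<Longrightarrow> i \<notin> K \<Longrightarrow> (j, i) \<in> ftcg_of D \<Longrightarrow> j \<in> S"
    and clamped: "\<And>i. i \<in> S \<Longrightarrow> i \<in> K \<Longrightarrow> z i = z' i"
    and z: "\<And>i. i \<in> S \<Longrightarrow> i \<notin> K \<Longrightarrow> z i = mech D (fst i) (history z (snd i)) (u i)"
    and z': "\<And>i. i \<in> S \<Longrightarrow> i \<notin> K \<Longrightarrow> z' i = mech D (fst i) (history z' (snd i)) (u i)"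
    and "i \<in> S"
  shows "z i = z' i"
  using wf_unclamped \<open>i \<in> S\<close>
proof (induction i)
  case (less i)
  show ?case
  proof (cases "i \<in> K")
    case False
    have "mech D (fst i) (history z (snd i)) (u i) = mech D (fst i) (history z' (snd i)) (u i)"
      by (rule history_cong_direct_causes) (use less False parents in blast)
    then show ?thesis using z z' less.prems False by metis
  qed (use clamped less.prems in blast)
qed

lemma clamped_solution_unfold:
  "clamped_solution D K f u i =
     (if i \<in> K then f i
      else mech D (fst i) (history (clamped_solution D K f u) (snd i)) (u i))"
  unfolding clamped_solution_def
  by (subst wfrec[OF wf_unclamped])
    (auto intro!: history_cong_direct_causes simp: cut_apply)

lemma clamped_solution_in: "i \<in> K \<Longrightarrow> clamped_solution D K f u i = f i"
  and clamped_solution_notin: "i \<notin> K \<Longrightarrow> clamped_solution D K f u i =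
      mech D (fst i) (history (clamped_solution D K f u) (snd i)) (u i)"
  using clamped_solution_unfold by metis+

lemma clamped_solution_cong:
  assumes parents: "\<And>i j. i \<in> S \<Longrightarrow> i \<notin> K \<Longrightarrow> (j, i) \<in> ftcg_of D \<Longrightarrow> j \<in> S"
    and "\<And>i. i \<in> S \<Longrightarrow> i \<in> K \<Longrightarrow> f i = f' i" "\<And>i. i \<in> S \<Longrightarrow> i \<notin> K \<Longrightarrow> u i = u' i"
    and "i \<in> S"
  shows "clamped_solution D K f u i = clamped_solution D K f' u' i"
proof (rule solutions_agree[where S = S and u = u])
  show "clamped_solution D K f' u' j =
      mech D (fst j) (history (clamped_solution D K f' u') (snd j)) (u j)"
    if "j \<in> S" "j \<notin> K" for j
    using clamped_solution_notin[OF that(2), of f' u'] assms(3)[OF that] by simp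
qed (use assms in \<open>auto simp: clamped_solution_in clamped_solution_notin\<close>)

lemma clamped_solution_eqI:
  assumes "\<And>i. i \<in> S \<Longrightarrow> i \<notin> K \<Longrightarrow> (\<And>j. (j, i) \<in> ftcg_of D \<Longrightarrow> j \<in> S)"
    and "\<And>i. i \<in> S \<Longrightarrow> i \<in> K \<Longrightarrow> z i = f i"
    and "\<And>i. i \<in> S \<Longrightarrow> i \<notin> K \<Longrightarrow> z i = mech D (fst i) (history z (snd i)) (u i)"
    and "i \<in> S"
  shows "z i = clamped_solution D K f u i"
  by (rule solutions_agree[where S = S and u = u])
    (use assms in \<open>auto simp: clamped_solution_in clamped_solution_notin\<close>)

text \<open>
Well-founded induction along the full-time graph. The history that enters a mechanism involves
vertices outside the scope of the induction hypothesis, such as later vertices of the same slice; they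
are not direct causes, so the history may be replaced by a constant there.
\<close>

lemma measurable_clamped_solution:
  assumes f: "\<And>i. (\<lambda>\<omega>. f \<omega> i) \<in> borel_measurable N"
    and u: "\<And>i. (\<lambda>\<omega>. u \<omega> i) \<in> borel_measurable N"
  shows "(\<lambda>\<omega>. clamped_solution D K (f \<omega>) (u \<omega>) i) \<in> borel_measurable N"
  using wf_unclamped
proof (induction i)
  case (less i)
  let ?Z = "\<lambda>\<omega>. clamped_solution D K (f \<omega>) (u \<omega>)"
  show ?case
  proof (cases "i \<in> K")
    case True
    then show ?thesis using f by (simp add: clamped_solution_in)
  next
    case False
    define h where "h \<omega> = (\<lambda>(A, l). if direct_cause D A l (fst i)
      then ?Z \<omega> (A, snd i - int l) else undefined)" for \<omega>
    have "mech D (fst i) (history (?Z \<omega>) (snd i)) (u \<omega> i) = mech D (fst i) (h \<omega>) (u \<omega> i)" for \<omega>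
      by (rule mech_cong_direct_causes[OF wf_mech]) (simp add: history_def h_def)
    then have eq: "?Z \<omega> i = (\<lambda>(h, u). mech D (fst i) h u) (h \<omega>, u \<omega> i)" for \<omega>
      using clamped_solution_notin[OF False] by simp
    have "(\<lambda>\<omega>. h \<omega> j) \<in> borel_measurable N" for j
    proof (cases j)
      case (Pair A l)
      show ?thesis
      proof (cases "direct_cause D A l (fst i)")
        case True
        then have "((A, snd i - int l), i) \<in> {(a, b) \<in> ftcg_of D. b \<notin> K}"
          using False by (cases i) (auto simp: ftcg_of_def)
        from less.IH[OF this] show ?thesis using True by (simp add: h_def Pair)
      qed (simp add: h_def Pair)
    qed
    then have "h \<in> measurable N (PiM UNIV (\<lambda>_. borel))"
      by (intro measurable_PiM_single') auto
    then have "(\<lambda>\<omega>. (h \<omega>, u \<omega> i)) \<in> measurable N (PiM UNIV (\<lambda>_. borel) \<Otimes>\<^sub>M borel)"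
      using u by (rule measurable_Pair)
    moreover have "(\<lambda>(h, u). mech D (fst i) h u) \<in> borel_measurable (PiM UNIV (\<lambda>_. borel) \<Otimes>\<^sub>M borel)"
      using wf_mech unfolding mechanisms_wf_def by blast
    ultimately show ?thesis unfolding eq by (rule measurable_compose)
  qed
qed

end

section \<open>Independence, disintegration and positive densities\<close>

text \<open>
Countability matters: it allows exchanging "for every event, almost everywhere" with "almost
everywhere, for every event".
\<close>

lemma countable_Int_stable_borel_generator:
  "\<exists>E :: 'a::second_countable_topology set set.
     countable E \<and> Int_stable E \<and> UNIV \<in> E \<and> sets borel = sigma_sets UNIV E"
proof -
  obtain B :: "'a set set" where B: "countable B" "topological_basis B"
    using ex_countable_basis by blast
  define E where "E = Inter ` {F. finite F \<and> F \<subseteq> B}"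
  have "countable E" unfolding E_def using B(1)
    by (intro countable_image countable_Collect_finite_subset)
  moreover have "Int_stable E"
  proof (rule Int_stableI)
    fix a b assume "a \<in> E" "b \<in> E"
    then obtain F G where "a = \<Inter>F" "b = \<Inter>G" "finite F" "finite G" "F \<subseteq> B" "G \<subseteq> B"
      unfolding E_def by blast
    then show "a \<inter> b \<in> E" unfolding E_def by (intro image_eqI[of _ _ "F \<union> G"]) auto
  qed
  moreover have "UNIV \<in> E" unfolding E_def by (intro image_eqI[of _ _ "{}"]) auto
  moreover have "sets borel = sigma_sets UNIV E"
  proof (rule antisym)
    have "B \<subseteq> E" unfolding E_def by (auto intro!: image_eqI[of _ _ "{b}" for b])
    then show "sets borel \<subseteq> sigma_sets UNIV E"
      unfolding borel_eq_countable_basis[OF B] by (simp add: sigma_sets_mono')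
    have "open U" if "U \<in> E" for U
      using that topological_basis_open[OF B(2)] unfolding E_def by (auto intro!: open_Inter)
    then have "E \<subseteq> sets borel" by auto
    then show "sigma_sets UNIV E \<subseteq> sets borel"
      using sets.sigma_sets_subset[of E borel] by simp
  qed
  ultimately show ?thesis by blast
qed

text \<open>
Independence of two random variables, stated through their joint law so that they may take values
in different types.
\<close>

definition law_factorizes ::
    "'w measure \<Rightarrow> 'b measure \<Rightarrow> ('w \<Rightarrow> 'b) \<Rightarrow> 'c measure \<Rightarrow> ('w \<Rightarrow> 'c) \<Rightarrow> bool" where
  "law_factorizes M N1 X N2 V \<longleftrightarrow>
     X \<in> measurable M N1 \<and> V \<in> measurable M N2 \<and>
     distr M (N1 \<Otimes>\<^sub>M N2) (\<lambda>\<omega>. (X \<omega>, V \<omega>)) = distr M N1 X \<Otimes>\<^sub>M distr M N2 V"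

lemma (in prob_space) law_factorizes_compose:
  assumes fac: "law_factorizes M N1 X N2 V"
    and f[measurable]: "f \<in> measurable N1 L1" and g[measurable]: "g \<in> measurable N2 L2"
  shows "law_factorizes M L1 (\<lambda>\<omega>. f (X \<omega>)) L2 (\<lambda>\<omega>. g (V \<omega>))"
proof -
  have [measurable]: "X \<in> measurable M N1" "V \<in> measurable M N2"
    and eq: "distr M N1 X \<Otimes>\<^sub>M distr M N2 V = distr M (N1 \<Otimes>\<^sub>M N2) (\<lambda>\<omega>. (X \<omega>, V \<omega>))"
    using fac unfolding law_factorizes_def by auto
  interpret PV: prob_space "distr M L2 (\<lambda>\<omega>. g (V \<omega>))" by (rule prob_space_distr) measurable
  have "distr M L1 (\<lambda>\<omega>. f (X \<omega>)) \<Otimes>\<^sub>M distr M L2 (\<lambda>\<omega>. g (V \<omega>))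
      = distr (distr M N1 X) L1 f \<Otimes>\<^sub>M distr (distr M N2 V) L2 g"
    by (simp add: distr_distr comp_def)
  also have "\<dots> = distr (distr M N1 X \<Otimes>\<^sub>M distr M N2 V) (L1 \<Otimes>\<^sub>M L2) (\<lambda>(x, v). (f x, g v))"
    by (rule pair_measure_distr)
      (use PV.sigma_finite_measure_axioms in \<open>simp_all add: distr_distr comp_def\<close>)
  also have "\<dots> = distr M (L1 \<Otimes>\<^sub>M L2) (\<lambda>\<omega>. (f (X \<omega>), g (V \<omega>)))"
    unfolding eq by (subst distr_distr) (simp_all add: comp_def)
  finally show ?thesis unfolding law_factorizes_def by simp
qed

text \<open>
By Fubini: for fixed x, the section of an event about (X, Y) and an event about Z is a rectangle,
whose probability under the law of (Y, Z) is a product.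
\<close>

lemma (in prob_space) law_factorizes_pair_assoc:
  assumes X_YZ: "law_factorizes M N1 X (N2 \<Otimes>\<^sub>M N3) (\<lambda>\<omega>. (Y \<omega>, Z \<omega>))"
    and Y_Z: "law_factorizes M N2 Y N3 Z"
  shows "law_factorizes M (N1 \<Otimes>\<^sub>M N2) (\<lambda>\<omega>. (X \<omega>, Y \<omega>)) N3 Z"
proof -
  have [measurable]: "X \<in> measurable M N1" "Y \<in> measurable M N2" "Z \<in> measurable M N3"
    using X_YZ Y_Z unfolding law_factorizes_def by auto
  interpret PX: prob_space "distr M N1 X" by (rule prob_space_distr) measurable
  interpret PY: prob_space "distr M N2 Y" by (rule prob_space_distr) measurable
  interpret PZ: prob_space "distr M N3 Z" by (rule prob_space_distr) measurable
  interpret PYZ: prob_space "distr M (N2 \<Otimes>\<^sub>M N3) (\<lambda>\<omega>. (Y \<omega>, Z \<omega>))"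
    by (rule prob_space_distr) measurable
  interpret PXY: prob_space "distr M (N1 \<Otimes>\<^sub>M N2) (\<lambda>\<omega>. (X \<omega>, Y \<omega>))"
    by (rule prob_space_distr) measurable
  have eq_YZ: "distr M (N2 \<Otimes>\<^sub>M N3) (\<lambda>\<omega>. (Y \<omega>, Z \<omega>)) = distr M N2 Y \<Otimes>\<^sub>M distr M N3 Z"
    using Y_Z unfolding law_factorizes_def by simp
  have eq_XYZ: "distr M (N1 \<Otimes>\<^sub>M (N2 \<Otimes>\<^sub>M N3)) (\<lambda>\<omega>. (X \<omega>, (Y \<omega>, Z \<omega>))) =
      distr M N1 X \<Otimes>\<^sub>M distr M (N2 \<Otimes>\<^sub>M N3) (\<lambda>\<omega>. (Y \<omega>, Z \<omega>))"
    using X_YZ unfolding law_factorizes_def by simp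
  have eq_XY: "distr M (N1 \<Otimes>\<^sub>M N2) (\<lambda>\<omega>. (X \<omega>, Y \<omega>)) = distr M N1 X \<Otimes>\<^sub>M distr M N2 Y"
    using law_factorizes_compose[OF X_YZ measurable_ident measurable_fst]
    unfolding law_factorizes_def by simp
  have "distr M (N1 \<Otimes>\<^sub>M N2) (\<lambda>\<omega>. (X \<omega>, Y \<omega>)) \<Otimes>\<^sub>M distr M N3 Z
      = distr M ((N1 \<Otimes>\<^sub>M N2) \<Otimes>\<^sub>M N3) (\<lambda>\<omega>. ((X \<omega>, Y \<omega>), Z \<omega>))"
  proof (rule pair_measure_eqI)
    fix A B assume "A \<in> sets (distr M (N1 \<Otimes>\<^sub>M N2) (\<lambda>\<omega>. (X \<omega>, Y \<omega>)))" "B \<in> sets (distr M N3 Z)"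
    then have [measurable]: "A \<in> sets (N1 \<Otimes>\<^sub>M N2)" "B \<in> sets N3" by auto
    define T where "T = {v \<in> space (N1 \<Otimes>\<^sub>M (N2 \<Otimes>\<^sub>M N3)). (fst v, fst (snd v)) \<in> A \<and> snd (snd v) \<in> B}"
    have [measurable]: "T \<in> sets (N1 \<Otimes>\<^sub>M (N2 \<Otimes>\<^sub>M N3))" unfolding T_def by measurable
    have "emeasure (distr M ((N1 \<Otimes>\<^sub>M N2) \<Otimes>\<^sub>M N3) (\<lambda>\<omega>. ((X \<omega>, Y \<omega>), Z \<omega>))) (A \<times> B)
        = emeasure (distr M (N1 \<Otimes>\<^sub>M (N2 \<Otimes>\<^sub>M N3)) (\<lambda>\<omega>. (X \<omega>, (Y \<omega>, Z \<omega>)))) T"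
      by (subst (1 2) emeasure_distr)
        (auto simp: T_def space_pair_measure intro!: arg_cong[where f = "emeasure M"]
          dest: measurable_space[OF \<open>X \<in> measurable M N1\<close>]
            measurable_space[OF \<open>Y \<in> measurable M N2\<close>] measurable_space[OF \<open>Z \<in> measurable M N3\<close>])
    also have "\<dots> = (\<integral>\<^sup>+x. emeasure (distr M N2 Y \<Otimes>\<^sub>M distr M N3 Z) (Pair x -` T) \<partial>distr M N1 X)"
      unfolding eq_XYZ by (subst PYZ.emeasure_pair_measure_alt) (simp_all add: eq_YZ)
    also have "\<dots> = (\<integral>\<^sup>+x. emeasure (distr M N2 Y) (Pair x -` A) * emeasure (distr M N3 Z) B
        \<partial>distr M N1 X)"
    proof (rule nn_integral_cong)
      fix x assume "x \<in> space (distr M N1 X)"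
      then have "Pair x -` T = (Pair x -` A) \<times> B"
        using sets.sets_into_space[OF \<open>A \<in> sets (N1 \<Otimes>\<^sub>M N2)\<close>] sets.sets_into_space[OF \<open>B \<in> sets N3\<close>]
        by (auto simp: T_def space_pair_measure)
      then show "emeasure (distr M N2 Y \<Otimes>\<^sub>M distr M N3 Z) (Pair x -` T)
          = emeasure (distr M N2 Y) (Pair x -` A) * emeasure (distr M N3 Z) B"
        by (simp add: PZ.emeasure_pair_measure_Times sets_Pair1)
    qed
    also have "\<dots> = (\<integral>\<^sup>+x. emeasure (distr M N2 Y) (Pair x -` A) \<partial>distr M N1 X)
        * emeasure (distr M N3 Z) B"
      by (rule nn_integral_multc) (intro PY.measurable_emeasure_Pair, simp)
    also have "\<dots> = emeasure (distr M (N1 \<Otimes>\<^sub>M N2) (\<lambda>\<omega>. (X \<omega>, Y \<omega>))) A * emeasure (distr M N3 Z) B"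
      unfolding eq_XY by (subst PY.emeasure_pair_measure_alt) simp_all
    finally show "emeasure (distr M (N1 \<Otimes>\<^sub>M N2) (\<lambda>\<omega>. (X \<omega>, Y \<omega>))) A * emeasure (distr M N3 Z) B =
        emeasure (distr M ((N1 \<Otimes>\<^sub>M N2) \<Otimes>\<^sub>M N3) (\<lambda>\<omega>. ((X \<omega>, Y \<omega>), Z \<omega>))) (A \<times> B)" ..
  qed (unfold_locales, simp)
  then show ?thesis unfolding law_factorizes_def by simp
qed

lemma (in prob_space) law_factorizes_disintegration:
  assumes fac: "law_factorizes M N1 X N2 V" and T: "T \<in> sets (N1 \<Otimes>\<^sub>M N2)"
  shows "emeasure M {\<omega> \<in> space M. (X \<omega>, V \<omega>) \<in> T} =
    (\<integral>\<^sup>+x. emeasure (distr M N2 V) (Pair x -` T) \<partial>distr M N1 X)"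
proof -
  have [measurable]: "X \<in> measurable M N1" "V \<in> measurable M N2"
    using fac unfolding law_factorizes_def by auto
  interpret PV: prob_space "distr M N2 V" by (rule prob_space_distr) measurable
  have "emeasure M {\<omega> \<in> space M. (X \<omega>, V \<omega>) \<in> T}
      = emeasure (distr M (N1 \<Otimes>\<^sub>M N2) (\<lambda>\<omega>. (X \<omega>, V \<omega>))) T"
    using T by (subst emeasure_distr) (auto intro!: arg_cong[where f = "emeasure M"])
  also have "\<dots> = emeasure (distr M N1 X \<Otimes>\<^sub>M distr M N2 V) T"
    using fac unfolding law_factorizes_def by simp
  also have "\<dots> = (\<integral>\<^sup>+x. emeasure (distr M N2 V) (Pair x -` T) \<partial>distr M N1 X)"
    using T by (subst PV.emeasure_pair_measure_alt) simp_all
  finally show ?thesis .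
qed

lemma (in product_sigma_finite) AE_PiM_insertD:
  assumes "finite I" "i \<notin> I" and "AE z in PiM (insert i I) M. Q z"
  shows "AE x in M i. AE w in PiM I M. Q (w(i := x))"
proof -
  interpret I: sigma_finite_measure "PiM I M" using assms(1) by (rule sigma_finite)
  obtain N where N: "{z \<in> space (PiM (insert i I) M). \<not> Q z} \<subseteq> N"
    "emeasure (PiM (insert i I) M) N = 0" "N \<in> sets (PiM (insert i I) M)"
    using assms(3) by (rule AE_E)
  note N(3)[measurable]
  have upd[measurable]: "(\<lambda>(x, w). w(i := x)) \<in> measurable (M i \<Otimes>\<^sub>M PiM I M) (PiM (insert i I) M)"
    by (auto simp: case_prod_beta intro!: measurable_fun_upd[where J=I] )
  have [measurable]: "(\<lambda>x. \<integral>\<^sup>+w. indicator N (w(i := x)) \<partial>PiM I M) \<in> borel_measurable (M i)"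
    by (rule I.borel_measurable_nn_integral) measurable
  have "0 = (\<integral>\<^sup>+z. indicator N z \<partial>PiM (insert i I) M)" using N by simp
  also have "\<dots> = (\<integral>\<^sup>+x. (\<integral>\<^sup>+w. indicator N (w(i := x)) \<partial>PiM I M) \<partial>M i)"
    by (rule product_nn_integral_insert_rev) (use assms in auto)
  finally have "AE x in M i. (\<integral>\<^sup>+w. indicator N (w(i := x)) \<partial>PiM I M) = 0"
    by (subst (asm) eq_commute) (simp add: nn_integral_0_iff_AE)
  with AE_space show ?thesis
  proof eventually_elim
    case x: (elim x)
    have [measurable]: "(\<lambda>w. w(i := x)) \<in> measurable (PiM I M) (PiM (insert i I) M)"
      using measurable_compose[OF measurable_Pair1'[OF x(1)] upd] by simp
    have "AE w in PiM I M. indicator N (w(i := x)) = (0 :: ennreal)"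
      using x(2) by (subst (asm) nn_integral_0_iff_AE) auto
    with AE_space show ?case
    proof eventually_elim
      case (elim w)
      then have "w(i := x) \<in> space (PiM (insert i I) M)"
        using x(1) by (auto simp: space_PiM PiE_fun_upd)
      then show ?case using elim(2) N(1) by (auto simp: indicator_eq_0_iff)
    qed
  qed
qed

text \<open>
The role of positivity in adjustment formulas: under a positive joint density, a statement that
holds almost surely for the jointly observed treatment and covariates also holds when the treatment
is varied independently of the covariates.
\<close>

lemma positive_distribution_AE_insert:
  fixes \<mu> :: "'v \<Rightarrow> 'a::topological_space measure"
  assumes borel_values: "\<And>V. sets (\<mu> V) = sets borel"
    and sigma_finite_values: "\<And>V. sigma_finite_measure (\<mu> V)"
    and pos: "positive_distribution \<mu> P" and W: "finite W" "i \<notin> W"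
    and Q: "AE z in distr P (PiM (insert i W) (\<lambda>_. borel)) (\<lambda>z. restrict z (insert i W)). Q z"
  shows "AE x in \<mu> (fst i). AE w in distr P (PiM W (\<lambda>_. borel)) (\<lambda>z. restrict z W). Q (w(i := x))"
proof -
  define \<mu>' where "\<mu>' = (\<lambda>(V, t :: int). \<mu> V)"
  have \<mu>'_eq: "\<mu>' i = \<mu> (fst i)" for i by (cases i) (simp add: \<mu>'_def)
  interpret product_sigma_finite \<mu>'
    by (rule product_sigma_finite.intro) (simp add: \<mu>'_eq sigma_finite_values)
  have dens: "\<exists>p \<in> borel_measurable (PiM S \<mu>'). (\<forall>z. 0 < (p z :: real)) \<and>
      distr P (PiM S (\<lambda>_. borel)) (\<lambda>z. restrict z S) = density (PiM S \<mu>') (\<lambda>z. ennreal (p z))"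
    if "finite S" for S
  proof -
    have "sets (PiM S (\<lambda>_. borel)) = sets (PiM S \<mu>')"
      by (rule sets_PiM_cong) (simp_all add: \<mu>'_eq borel_values)
    then have "distr P (PiM S (\<lambda>_. borel)) (\<lambda>z. restrict z S) = distr P (PiM S \<mu>') (\<lambda>z. restrict z S)"
      by (intro distr_cong) auto
    then show ?thesis using pos that unfolding positive_distribution_def \<mu>'_def by metis
  qed
  from dens[of "insert i W"] W(1) obtain p where p: "p \<in> borel_measurable (PiM (insert i W) \<mu>')"
    "\<And>z. 0 < p z" "distr P (PiM (insert i W) (\<lambda>_. borel)) (\<lambda>z. restrict z (insert i W))
      = density (PiM (insert i W) \<mu>') (\<lambda>z. ennreal (p z))"
    by auto
  from dens[OF W(1)] obtain q where q: "q \<in> borel_measurable (PiM W \<mu>')"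
    "distr P (PiM W (\<lambda>_. borel)) (\<lambda>z. restrict z W) = density (PiM W \<mu>') (\<lambda>z. ennreal (q z))"
    by auto
  have "AE z in PiM (insert i W) \<mu>'. Q z"
    using Q p(1,2) unfolding p(3) by (simp add: AE_density)
  then have "AE x in \<mu>' i. AE w in PiM W \<mu>'. Q (w(i := x))"
    by (rule AE_PiM_insertD[OF W])
  then have "AE x in \<mu> (fst i). AE w in PiM W \<mu>'. Q (w(i := x))" unfolding \<mu>'_eq .
  then show ?thesis
  proof eventually_elim
    case (elim x)
    then show ?case unfolding q(2) using q(1) by (auto simp: AE_density)
  qed
qed

lemma law_factorizes_cong_AE:
  assumes fac: "law_factorizes M N1 X N2 V" and X': "X' \<in> measurable M N1"
    and ae: "AE \<omega> in M. X \<omega> = X' \<omega>"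
  shows "law_factorizes M N1 X' N2 V"
proof -
  have [measurable]: "X \<in> measurable M N1" "V \<in> measurable M N2" "X' \<in> measurable M N1"
    using fac X' unfolding law_factorizes_def by auto
  have "distr M N1 X = distr M N1 X'"
    by (rule distr_cong_AE) (use ae in auto)
  moreover have "distr M (N1 \<Otimes>\<^sub>M N2) (\<lambda>\<omega>. (X \<omega>, V \<omega>)) = distr M (N1 \<Otimes>\<^sub>M N2) (\<lambda>\<omega>. (X' \<omega>, V \<omega>))"
    by (rule distr_cong_AE) (use ae in auto)
  ultimately show ?thesis using fac unfolding law_factorizes_def by simp
qed

section \<open>Treatment and outcome as functions of disjoint noises\<close>

text \<open>
Everything before time s that a mechanism from time s on can read, and the instances at time s of the
series that, by the summary graph, cannot be affected by X. It is computed from the summary graph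
alone and hence the same for all candidate full-time graphs.
\<close>

definition adjustment_set :: "nat \<Rightarrow> 'v scg \<Rightarrow> 'v \<Rightarrow> int \<Rightarrow> 'v instance_at set" where
  "adjustment_set \<gamma>max E X s =
     {(V, r). s - int \<gamma>max \<le> r \<and> r < s} \<union> {(V, r). r = s \<and> V \<notin> Desc X E}"

lemma finite_adjustment_set:
  fixes X :: "'v::finite"
  shows "finite (adjustment_set \<gamma>max E X s)"
  by (rule finite_subset[of _ "UNIV \<times> {s - int \<gamma>max..s}"]) (auto simp: adjustment_set_def)

lemma treatment_notin_adjustment_set: "(X, s) \<notin> adjustment_set \<gamma>max E X s"
  by (auto simp: adjustment_set_def Desc_def)

locale effect_identification =
  fixes \<gamma>max \<gamma> :: nat and \<mu> :: "'v::finite \<Rightarrow> 'a::topological_space measure"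
    and D :: "('v, 'a) dscm" and E :: "'v scg" and X Y :: 'v and s t :: int
  assumes dscm: "is_dscm \<gamma>max \<mu> D"
    and candidate: "ftcg_of D \<in> candidate_ftcgs \<gamma>max E"
    and distinct: "X \<noteq> Y"
    and condition: "effect_identification_condition E X Y \<gamma>"
    and time: "t = s + int \<gamma>"
begin

abbreviation "past \<equiv> {i :: 'v instance_at. snd i < s}"
abbreviation "future \<equiv> {i :: 'v instance_at. s \<le> snd i}"
abbreviation "adj \<equiv> adjustment_set \<gamma>max E X s"
abbreviation "adjX \<equiv> insert (X, s) adj"

abbreviation "K_do \<equiv> insert (X, s) past"
abbreviation "K_adj \<equiv> past \<union> adjX"

text \<open>
The noises through which the outcome depends on more than the treatment and the adjustment variables:
those of the vertices that reach (Y, t) along a path not meeting the clamped vertices.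
\<close>

definition outcome_noises :: "'v instance_at set" where
  "outcome_noises = {i. (i, (Y, t)) \<in> {(a, b) \<in> ftcg_of D. b \<notin> K_adj}\<^sup>*} - K_adj"

text \<open>
The noises that, together with the past, determine the treatment and the adjustment variables.
\<close>

definition treatment_noises :: "'v instance_at set" where
  "treatment_noises = {i. snd i = s \<and> (fst i \<notin> Desc X E \<or> (i, (X, s)) \<in> (ftcg_of D)\<^sup>*)}"

definition solves :: "('v instance_at \<Rightarrow> 'a) \<Rightarrow> ('v instance_at \<Rightarrow> real) \<Rightarrow> bool" where
  "solves z u \<longleftrightarrow> (\<forall>i. z i = mech D (fst i) (history z (snd i)) (u i))"

text \<open>
The outcome as a function of treatment, adjustment variables and outcome noises. It is the same
function in the factual world and under the intervention. The restrictions only make its dependence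
on the remaining coordinates explicit.
\<close>

definition response :: "('v instance_at \<Rightarrow> 'a) \<Rightarrow> ('v instance_at \<Rightarrow> real) \<Rightarrow> 'a" where
  "response f a = clamped_solution D K_adj (restrict f adjX) (restrict a outcome_noises) (Y, t)"

lemma wf_mech: "mechanisms_wf \<gamma>max D" and acyclic_ftcg: "acyclic (ftcg_of D)"
  using dscm unfolding is_dscm_def by auto

sublocale factual: clamped_model \<gamma>max D s past
  by unfold_locales (use wf_mech acyclic_ftcg in auto)
sublocale intervened: clamped_model \<gamma>max D s K_do
  by unfold_locales (use wf_mech acyclic_ftcg in auto)
sublocale adjusted: clamped_model \<gamma>max D s K_adj
  by unfold_locales (use wf_mech acyclic_ftcg in auto)

lemma edge:
  assumes "(j, i) \<in> ftcg_of D"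
  shows "(fst j, fst i) \<in> E" "snd j \<le> snd i" "snd i - snd j \<le> int \<gamma>max"
  using ftcg_edge_summary[OF candidate, of "fst j" "snd j" "fst i" "snd i"] assms by auto

text \<open>
A noise in both sets would belong to a confounder in the slice of the treatment that escapes
adjustment.
\<close>

lemma noises_disjoint: "treatment_noises \<inter> outcome_noises = {}"
proof safe
  fix Z r assume i: "(Z, r) \<in> treatment_noises" "(Z, r) \<in> outcome_noises"
  then have r: "r = s" unfolding treatment_noises_def by simp
  have notin: "(Z, s) \<notin> K_adj" using i(2) r unfolding outcome_noises_def by blast
  then have Z: "Z \<in> Desc X E" "Z \<noteq> X" by (auto simp: adjustment_set_def)
  then have ZX: "((Z, s), (X, s)) \<in> (ftcg_of D)\<^sup>*" using i(1) r unfolding treatment_noises_def by simp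
  have "((Z, s), (Y, t)) \<in> {(a, b) \<in> ftcg_of D. b \<notin> K_adj}\<^sup>*"
    using i(2) r unfolding outcome_noises_def by blast
  then have "((Z, s), (Y, t)) \<in> {(a, b) \<in> ftcg_of D. b \<noteq> (X, s)}\<^sup>*"
    by (rule rtrancl_mono[THEN subsetD, rotated]) auto
  then show "(Z, r) \<in> {}"
    using no_unadjusted_confounder_in_slice[OF condition distinct candidate time Z ZX] by blast
qed

lemma treatment_noises_future: "treatment_noises \<subseteq> future"
  and outcome_noises_future: "outcome_noises \<subseteq> future"
  unfolding treatment_noises_def outcome_noises_def by auto

lemma do_trajectory_eq_clamped:
  "do_trajectory D X s x \<omega> = clamped_solution D K_do ((fst \<omega>)((X, s) := x)) (snd \<omega>)"
  unfolding do_trajectory_def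
proof (rule the1_equality[OF do_solution_ex1[OF wf_mech acyclic_ftcg]])
  let ?z = "clamped_solution D K_do ((fst \<omega>)((X, s) := x)) (snd \<omega>)"
  have "?z (V, r) = mech D V (history ?z r) (snd \<omega> (V, r))" if "s \<le> r" "(V, r) \<noteq> (X, s)" for V r
    using intervened.clamped_solution_notin[of "(V, r)"] that by simp
  then show "do_solution D X s x \<omega> ?z"
    unfolding do_solution_def by (auto simp: case_prod_beta intervened.clamped_solution_in)
qed

lemma nondescendants_unaffected:
  assumes sol: "solves z u" and V: "V \<notin> Desc X E"
  shows "clamped_solution D K_do (z((X, s) := x)) u (V, r) = z (V, r)"
proof (rule factual.solutions_agree[where S = "{i. fst i \<notin> Desc X E \<or> snd i < s}" and u = u])
  fix i j assume "i \<in> {i. fst i \<notin> Desc X E \<or> snd i < s}" "i \<notin> past" "(j, i) \<in> ftcg_of D"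
  then show "j \<in> {i. fst i \<notin> Desc X E \<or> snd i < s}"
    using edge(1)[of j i] unfolding Desc_def by (auto intro: rtrancl_into_rtrancl)
next
  fix i assume i: "i \<in> {i. fst i \<notin> Desc X E \<or> snd i < s}" "i \<notin> past"
  then have "i \<notin> K_do" unfolding Desc_def by auto
  then show "clamped_solution D K_do (z((X, s) := x)) u i =
      mech D (fst i) (history (clamped_solution D K_do (z((X, s) := x)) u) (snd i)) (u i)"
    by (rule intervened.clamped_solution_notin)
next
  fix i assume "i \<in> past"
  then have "i \<in> K_do" "i \<noteq> (X, s)" by auto
  then show "clamped_solution D K_do (z((X, s) := x)) u i = z i"
    using intervened.clamped_solution_in[of i] by (simp del: insert_iff)
qed (use sol V in \<open>auto simp: solves_def\<close>)

lemma response_cong: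
  assumes f: "\<And>i. i \<in> adjX \<Longrightarrow> f i = f' i" and u: "\<And>i. i \<in> outcome_noises \<Longrightarrow> u i = u' i"
  shows "clamped_solution D K_adj f u (Y, t) = clamped_solution D K_adj f' u' (Y, t)"
proof (rule adjusted.clamped_solution_cong
    [where S = "{i. (i, (Y, t)) \<in> {(a, b) \<in> ftcg_of D. b \<notin> K_adj}\<^sup>*}"])
  \<comment> \<open>A path from the past enters the unclamped region by a single edge, of lag at most
    \<open>\<gamma>max\<close>; so only the window before s matters.\<close>
  fix i assume i: "i \<in> {i. (i, (Y, t)) \<in> {(a, b) \<in> ftcg_of D. b \<notin> K_adj}\<^sup>*}" "i \<in> K_adj"
  have "i \<in> adjX"
  proof (rule ccontr)
    assume no: "i \<notin> adjX"
    then have "snd i < s" using i(2) by blast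
    then have "i \<noteq> (Y, t)" using time by auto
    moreover have "(i, (Y, t)) \<in> {(a, b) \<in> ftcg_of D. b \<notin> K_adj}\<^sup>*" using i(1) by blast
    ultimately obtain b where "(i, b) \<in> ftcg_of D" "b \<notin> K_adj"
      by (blast elim: converse_rtranclE)
    then have "s \<le> snd b" "snd b - snd i \<le> int \<gamma>max" using edge(3) by auto
    then show False using no \<open>snd i < s\<close> unfolding adjustment_set_def by (cases i) auto
  qed
  then show "f i = f' i" by (rule f)
qed (use u in \<open>auto simp: outcome_noises_def intro: converse_rtrancl_into_rtrancl\<close>)

text \<open>
The adjustment variables keep their factual values under the intervention, so clamping them to
these values does not change the interventional trajectory.
\<close>

lemma do_trajectory_eq_response:
  assumes "solves z u"
  shows "do_trajectory D X s x (z, u) (Y, t) =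
    response ((restrict z adj)((X, s) := x)) (restrict u outcome_noises)"
proof -
  let ?z = "clamped_solution D K_do (z((X, s) := x)) u"
  have "do_trajectory D X s x (z, u) (Y, t) = ?z (Y, t)"
    by (simp add: do_trajectory_eq_clamped)
  also have "\<dots> = clamped_solution D K_adj (z((X, s) := x)) u (Y, t)"
  proof (rule adjusted.clamped_solution_eqI[where S = UNIV])
    fix i assume i: "i \<in> K_adj"
    show "?z i = (z((X, s) := x)) i"
    proof (cases "i \<in> K_do")
      case True
      then show ?thesis by (rule intervened.clamped_solution_in)
    next
      case False
      then have "fst i \<notin> Desc X E" "i \<noteq> (X, s)" using i unfolding adjustment_set_def by auto
      then show ?thesis using nondescendants_unaffected[OF assms, of "fst i" x "snd i"] by simp
    qed
  next
    fix i assume "i \<notin> K_adj"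
    then have "i \<notin> K_do" by blast
    then show "?z i = mech D (fst i) (history ?z (snd i)) (u i)"
      by (rule intervened.clamped_solution_notin)
  qed auto
  also have "\<dots> = response ((restrict z adj)((X, s) := x)) (restrict u outcome_noises)"
    unfolding response_def by (rule response_cong) auto
  finally show ?thesis .
qed

lemma outcome_eq_response:
  assumes "solves z u"
  shows "z (Y, t) = response (restrict z adjX) (restrict u outcome_noises)"
proof -
  have "z (Y, t) = clamped_solution D K_adj z u (Y, t)"
    by (rule adjusted.clamped_solution_eqI[where S = UNIV]) (use assms in \<open>auto simp: solves_def\<close>)
  also have "\<dots> = response (restrict z adjX) (restrict u outcome_noises)"
    unfolding response_def by (rule response_cong) auto
  finally show ?thesis .
qed

lemma treatment_eq_clamped:
  assumes "solves z u"
  shows "restrict z adjX = (\<lambda>i\<in>adjX. clamped_solution D past (restrict z past)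
    (restrict u treatment_noises) i)"
proof (rule restrict_ext)
  fix i assume i: "i \<in> adjX"
  let ?S = "past \<union> treatment_noises"
  have closed: "j \<in> ?S" if "k \<in> ?S" "k \<notin> past" "(j, k) \<in> ftcg_of D" for j k
  proof (cases "snd j = s")
    case True
    have "snd k = s" using that unfolding treatment_noises_def by auto
    then show ?thesis using that edge(1)[OF that(3)] True unfolding treatment_noises_def Desc_def
      by (auto intro: rtrancl_into_rtrancl converse_rtrancl_into_rtrancl)
  next
    case False
    have "snd k = s" using that unfolding treatment_noises_def by auto
    then show ?thesis using edge(2)[OF that(3)] False by auto
  qed
  have "i \<in> ?S" using i unfolding adjustment_set_def treatment_noises_def by auto
  have "z i = clamped_solution D past z u i"
    by (rule factual.clamped_solution_eqI[where S = UNIV]) (use assms in \<open>auto simp: solves_def\<close>)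
  also have "\<dots> = clamped_solution D past (restrict z past) (restrict u treatment_noises) i"
    by (rule factual.clamped_solution_cong[where S = ?S]) (use closed \<open>i \<in> ?S\<close> in auto)
  finally show "z i = clamped_solution D past (restrict z past) (restrict u treatment_noises) i" .
qed

end

section \<open>The adjustment formula\<close>

context effect_identification
begin

sublocale prob_space "law D"
  using dscm unfolding is_dscm_def by blast

lemma sets_law: "sets (law D) = sets (PiM UNIV (\<lambda>_. borel) \<Otimes>\<^sub>M PiM UNIV (\<lambda>_. borel))"
  using dscm unfolding is_dscm_def by blast

lemma measurable_fst_law[measurable]: "fst \<in> measurable (law D) (PiM UNIV (\<lambda>_. borel))"
  and measurable_snd_law[measurable]: "snd \<in> measurable (law D) (PiM UNIV (\<lambda>_. borel))"
  by (simp_all add: measurable_cong_sets[OF sets_law refl])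

lemma measurable_value[measurable]: "(\<lambda>\<omega>. fst \<omega> i) \<in> borel_measurable (law D)"
  and measurable_noise[measurable]: "(\<lambda>\<omega>. snd \<omega> i) \<in> borel_measurable (law D)"
  using measurable_compose[OF measurable_fst_law measurable_component_singleton[of i UNIV]]
    measurable_compose[OF measurable_snd_law measurable_component_singleton[of i UNIV]] by auto

lemma measurable_values[measurable]:
    "(\<lambda>\<omega>. restrict (fst \<omega>) J) \<in> measurable (law D) (PiM J (\<lambda>_. borel))"
  and measurable_noises[measurable]:
    "(\<lambda>\<omega>. restrict (snd \<omega>) J) \<in> measurable (law D) (PiM J (\<lambda>_. borel))"
  by (intro measurable_restrict measurable_value measurable_noise)+

lemma AE_solves: "AE \<omega> in law D. solves (fst \<omega>) (snd \<omega>)"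
proof -
  have "AE (z, u) in law D. \<forall>V t. z (V, t) = mech D V (history z t) (u (V, t))"
    using dscm unfolding is_dscm_def solves_equations_def by blast
  then show ?thesis by (simp add: solves_def case_prod_beta)
qed

lemma past_factorizes_future:
  "law_factorizes (law D) (PiM past (\<lambda>_. borel)) (\<lambda>\<omega>. restrict (fst \<omega>) past)
     (PiM future (\<lambda>_. borel)) (\<lambda>\<omega>. restrict (snd \<omega>) future)"
proof -
  have "nonanticipative D" using dscm unfolding is_dscm_def by blast
  then show ?thesis
    unfolding nonanticipative_def law_factorizes_def Let_def
    by (simp add: case_prod_unfold)
qed

lemma noises_factorize:
  assumes "I \<inter> J = {}"
  shows "law_factorizes (law D) (PiM I (\<lambda>_. borel)) (\<lambda>\<omega>. restrict (snd \<omega>) I)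
     (PiM J (\<lambda>_. borel)) (\<lambda>\<omega>. restrict (snd \<omega>) J)"
proof -
  have "indep_vars (\<lambda>_. borel) (\<lambda>i \<omega>. snd \<omega> i) UNIV"
    using dscm unfolding is_dscm_def independent_noises_def by (simp add: case_prod_unfold)
  from indep_var_restrict[OF this assms] show ?thesis
    unfolding indep_var_distribution_eq law_factorizes_def by simp
qed

text \<open>
The past, the treatment noises and the outcome noises are independent, and treatment and adjustment
variables are functions of the first two. This independence is what makes the adjustment valid.
\<close>

lemma adjX_factorizes_outcome_noises:
  "law_factorizes (law D) (PiM adjX (\<lambda>_. borel)) (\<lambda>\<omega>. restrict (fst \<omega>) adjX)
     (PiM outcome_noises (\<lambda>_. borel)) (\<lambda>\<omega>. restrict (snd \<omega>) outcome_noises)"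
proof -
  let ?N = "\<lambda>J. PiM J (\<lambda>_. borel :: real measure)"
  let ?V = "\<lambda>J. PiM J (\<lambda>_. borel :: 'a measure)"
  let ?u = "\<lambda>J \<omega>. restrict (snd \<omega> :: 'v instance_at \<Rightarrow> real) J"
  let ?z = "\<lambda>J \<omega>. restrict (fst \<omega> :: 'v instance_at \<Rightarrow> 'a) J"
  define h where "h = (\<lambda>(p :: 'v instance_at \<Rightarrow> 'a, b).
    \<lambda>i\<in>adjX. clamped_solution D past (restrict p past) (restrict b treatment_noises) i)"
  have "law_factorizes (law D) (?V past) (\<lambda>\<omega>. id (?z past \<omega>))
     (?N treatment_noises \<Otimes>\<^sub>M ?N outcome_noises)
     (\<lambda>\<omega>. (\<lambda>v. (restrict v treatment_noises, restrict v outcome_noises)) (?u future \<omega>))"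
    by (rule law_factorizes_compose[OF past_factorizes_future])
      (intro measurable_ident measurable_Pair measurable_restrict_subset
        treatment_noises_future outcome_noises_future)+
  then have "law_factorizes (law D) (?V past) (?z past)
     (?N treatment_noises \<Otimes>\<^sub>M ?N outcome_noises)
     (\<lambda>\<omega>. (?u treatment_noises \<omega>, ?u outcome_noises \<omega>))"
    using treatment_noises_future outcome_noises_future
    by (simp add: restrict_restrict Int_absorb1)
  from law_factorizes_pair_assoc[OF this noises_factorize[OF noises_disjoint]]
  have fac: "law_factorizes (law D) (?V past \<Otimes>\<^sub>M ?N treatment_noises)
     (\<lambda>\<omega>. (?z past \<omega>, ?u treatment_noises \<omega>)) (?N outcome_noises) (?u outcome_noises)" .
  have h: "h \<in> measurable (?V past \<Otimes>\<^sub>M ?N treatment_noises) (?V adjX)"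
    unfolding h_def case_prod_beta
  proof (intro measurable_restrict factual.measurable_clamped_solution)
    show "(\<lambda>\<omega>. restrict (fst \<omega>) past i) \<in> borel_measurable (?V past \<Otimes>\<^sub>M ?N treatment_noises)" for i
      by (cases "i \<in> past")
        (auto intro!: measurable_compose[OF measurable_fst] measurable_component_singleton)
    show "(\<lambda>\<omega>. restrict (snd \<omega>) treatment_noises i)
        \<in> borel_measurable (?V past \<Otimes>\<^sub>M ?N treatment_noises)" for i
      by (cases "i \<in> treatment_noises")
        (auto intro!: measurable_compose[OF measurable_snd] measurable_component_singleton)
  qed
  have "law_factorizes (law D) (?V adjX) (\<lambda>\<omega>. h (?z past \<omega>, ?u treatment_noises \<omega>))
      (?N outcome_noises) (?u outcome_noises)"
    using law_factorizes_compose[OF fac h measurable_ident] by simp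
  then show ?thesis
  proof (rule law_factorizes_cong_AE)
    show "AE \<omega> in law D. h (?z past \<omega>, ?u treatment_noises \<omega>) = ?z adjX \<omega>"
      using AE_solves
    proof eventually_elim
      case (elim \<omega>)
      show ?case unfolding h_def using treatment_eq_clamped[OF elim] by (simp add: restrict_restrict)
    qed
  qed measurable
qed

lemma measurable_response:
  "(\<lambda>(f, a). response f a) \<in>
     borel_measurable (PiM adjX (\<lambda>_. borel) \<Otimes>\<^sub>M PiM outcome_noises (\<lambda>_. borel))"
  unfolding response_def case_prod_beta
proof (rule adjusted.measurable_clamped_solution)
  let ?N = "PiM adjX (\<lambda>_. borel :: 'a measure) \<Otimes>\<^sub>M PiM outcome_noises (\<lambda>_. borel :: real measure)"
  show "(\<lambda>p. restrict (fst p) adjX i) \<in> borel_measurable ?N" for i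
    by (cases "i \<in> adjX")
      (auto intro!: measurable_compose[OF measurable_fst] measurable_component_singleton)
  show "(\<lambda>p. restrict (snd p) outcome_noises i) \<in> borel_measurable ?N" for i
    by (cases "i \<in> outcome_noises")
      (auto intro!: measurable_compose[OF measurable_snd] measurable_component_singleton)
qed

lemma measurable_do_trajectory:
  "(\<lambda>\<omega>. do_trajectory D X s x \<omega> i) \<in> borel_measurable (law D)"
  unfolding do_trajectory_eq_clamped
proof (rule intervened.measurable_clamped_solution)
  show "(\<lambda>\<omega>. ((fst \<omega>)((X, s) := x)) j) \<in> borel_measurable (law D)" for j
    by (cases "j = (X, s)") auto
qed measurable

lemma prob_space_total_effect: "prob_space (total_effect D X s x Y t)"
  unfolding total_effect_def by (rule prob_space_distr) (rule measurable_do_trajectory)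

lemma distr_observational:
  "distr (observational D) (PiM J (\<lambda>_. borel)) (\<lambda>z. restrict z J) =
   distr (law D) (PiM J (\<lambda>_. borel)) (\<lambda>\<omega>. restrict (fst \<omega>) J)"
  unfolding observational_def
  by (subst distr_distr) (auto simp: comp_def intro!: measurable_restrict_subset)

text \<open>
The backdoor adjustment formula. The first integral identity says that \<open>\<kappa> B\<close> is a version of the
conditional probability of the outcome lying in B given treatment and adjustment variables; the second
obtains the effect by fixing the treatment in \<open>\<kappa> B\<close> and averaging over the adjustment variables.

The kernel is the law of the response to fixed treatment and covariates when only the outcome noises
are random. As these are independent of treatment and covariates, the same kernel describes the
observed outcome and the interventional one.
\<close>

lemma backdoor_adjustment:
  "\<exists>\<kappa> :: 'a set \<Rightarrow> ('v instance_at \<Rightarrow> 'a) \<Rightarrow> ennreal. \<forall>B \<in> sets borel.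
     \<kappa> B \<in> borel_measurable (PiM adjX (\<lambda>_. borel)) \<and>
     (\<forall>C \<in> sets (PiM adjX (\<lambda>_. borel)).
        emeasure (observational D) {z \<in> space (observational D). restrict z adjX \<in> C \<and> z (Y, t) \<in> B} =
        (\<integral>\<^sup>+ f. \<kappa> B f * indicator C f
          \<partial>distr (observational D) (PiM adjX (\<lambda>_. borel)) (\<lambda>z. restrict z adjX))) \<and>
     (\<forall>x. emeasure (total_effect D X s x Y t) B =
        (\<integral>\<^sup>+ w. \<kappa> B (w((X, s) := x))
          \<partial>distr (observational D) (PiM adj (\<lambda>_. borel)) (\<lambda>z. restrict z adj)))"
proof -
  let ?VX = "PiM adjX (\<lambda>_. borel :: 'a measure)"
  let ?VW = "PiM adj (\<lambda>_. borel :: 'a measure)"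
  let ?N = "PiM outcome_noises (\<lambda>_. borel :: real measure)"
  let ?zX = "\<lambda>\<omega>. restrict (fst \<omega> :: 'v instance_at \<Rightarrow> 'a) adjX"
  let ?zW = "\<lambda>\<omega>. restrict (fst \<omega> :: 'v instance_at \<Rightarrow> 'a) adj"
  let ?u = "\<lambda>\<omega>. restrict (snd \<omega> :: 'v instance_at \<Rightarrow> real) outcome_noises"
  define \<nu> where "\<nu> = distr (law D) ?N ?u"
  interpret \<nu>: prob_space \<nu> unfolding \<nu>_def by (rule prob_space_distr) measurable
  define T where "T B = (\<lambda>(f, a). response f a) -` B \<inter> space (?VX \<Otimes>\<^sub>M ?N)" for B
  define \<kappa> where "\<kappa> B f = emeasure \<nu> (Pair f -` T B)" for B f
  have fac: "law_factorizes (law D) ?VX ?zX ?N ?u" by (rule adjX_factorizes_outcome_noises)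
  have upd: "(\<lambda>w. w((X, s) := x)) \<in> measurable ?VW ?VX" for x
    by (rule measurable_fun_upd[where J = adj]) auto
  have facW: "law_factorizes (law D) ?VW ?zW ?N ?u"
  proof -
    have "law_factorizes (law D) ?VW (\<lambda>\<omega>. (\<lambda>f. restrict f adj) (?zX \<omega>)) ?N (\<lambda>\<omega>. id (?u \<omega>))"
      by (rule law_factorizes_compose[OF fac])
        (intro measurable_ident measurable_restrict_subset subset_insertI)+
    then show ?thesis by (simp add: restrict_restrict Int_absorb1 subset_insertI)
  qed
  show ?thesis
  proof (intro exI[of _ \<kappa>] ballI conjI allI)
    fix B :: "'a set" assume B: "B \<in> sets borel"
    have T[measurable]: "T B \<in> sets (?VX \<Otimes>\<^sub>M ?N)"
      unfolding T_def by (rule measurable_sets[OF measurable_response B])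
    show "\<kappa> B \<in> borel_measurable ?VX"
      unfolding \<kappa>_def by (rule \<nu>.measurable_emeasure_Pair) (simp add: \<nu>_def)
    have outcome: "AE \<omega> in law D. fst \<omega> (Y, t) = response (?zX \<omega>) (?u \<omega>)"
      using AE_solves by eventually_elim (rule outcome_eq_response)
    fix C assume C[measurable]: "C \<in> sets ?VX"
    have TC: "T B \<inter> C \<times> space ?N \<in> sets (?VX \<Otimes>\<^sub>M ?N)" by measurable
    have "emeasure (observational D)
        {z \<in> space (observational D). restrict z adjX \<in> C \<and> z (Y, t) \<in> B}
      = emeasure (law D) {\<omega> \<in> space (law D). ?zX \<omega> \<in> C \<and> fst \<omega> (Y, t) \<in> B}"
    proof -
      have "{z \<in> space (PiM UNIV (\<lambda>_. borel)). restrict z adjX \<in> C \<and> z (Y, t) \<in> B}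
          \<in> sets (PiM UNIV (\<lambda>_. borel :: 'a measure))"
        using B C by measurable
      then show ?thesis unfolding observational_def
        by (subst emeasure_distr) (auto intro!: arg_cong[where f = "emeasure (law D)"] simp: space_PiM)
    qed
    also have "\<dots> = emeasure (law D) {\<omega> \<in> space (law D). (?zX \<omega>, ?u \<omega>) \<in> T B \<inter> C \<times> space ?N}"
    proof (rule emeasure_eq_AE)
      show "AE \<omega> in law D. (\<omega> \<in> {\<omega> \<in> space (law D). ?zX \<omega> \<in> C \<and> fst \<omega> (Y, t) \<in> B}) =
          (\<omega> \<in> {\<omega> \<in> space (law D). (?zX \<omega>, ?u \<omega>) \<in> T B \<inter> C \<times> space ?N})"
        using outcome
      proof eventually_elim
        case (elim \<omega>)
        then show ?case by (auto simp: T_def space_pair_measure space_PiM)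
      qed
      show "{\<omega> \<in> space (law D). ?zX \<omega> \<in> C \<and> fst \<omega> (Y, t) \<in> B} \<in> events"
        using B C by measurable
      show "{\<omega> \<in> space (law D). (?zX \<omega>, ?u \<omega>) \<in> T B \<inter> C \<times> space ?N} \<in> events"
        using TC by measurable
    qed
    also have "\<dots> = (\<integral>\<^sup>+f. emeasure \<nu> (Pair f -` (T B \<inter> C \<times> space ?N)) \<partial>distr (law D) ?VX ?zX)"
      unfolding \<nu>_def by (rule law_factorizes_disintegration[OF fac TC])
    also have "\<dots> = (\<integral>\<^sup>+f. \<kappa> B f * indicator C f \<partial>distr (law D) ?VX ?zX)"
    proof (rule nn_integral_cong)
      fix f
      have "Pair f -` (T B \<inter> C \<times> space ?N) = (if f \<in> C then Pair f -` T B else {})"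
        by (auto simp: T_def space_pair_measure)
      then show "emeasure \<nu> (Pair f -` (T B \<inter> C \<times> space ?N)) = \<kappa> B f * indicator C f"
        by (simp add: \<kappa>_def)
    qed
    finally show "emeasure (observational D)
        {z \<in> space (observational D). restrict z adjX \<in> C \<and> z (Y, t) \<in> B} =
      (\<integral>\<^sup>+f. \<kappa> B f * indicator C f \<partial>distr (observational D) ?VX (\<lambda>z. restrict z adjX))"
      unfolding distr_observational .
  next
    fix B :: "'a set" and x assume B: "B \<in> sets borel"
    have T[measurable]: "T B \<in> sets (?VX \<Otimes>\<^sub>M ?N)"
      unfolding T_def by (rule measurable_sets[OF measurable_response B])
    define T' where "T' = (\<lambda>(w, a). (w((X, s) := x), a)) -` T B \<inter> space (?VW \<Otimes>\<^sub>M ?N)"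
    have "(\<lambda>(w, a). (w((X, s) := x), a)) \<in> measurable (?VW \<Otimes>\<^sub>M ?N) (?VX \<Otimes>\<^sub>M ?N)"
      using measurable_compose[OF measurable_fst upd] by (auto simp: case_prod_beta intro!: measurable_Pair)
    from measurable_sets[OF this T] have T': "T' \<in> sets (?VW \<Otimes>\<^sub>M ?N)"
      unfolding T'_def .
    have response: "AE \<omega> in law D.
        do_trajectory D X s x \<omega> (Y, t) = response ((?zW \<omega>)((X, s) := x)) (?u \<omega>)"
      using AE_solves
    proof eventually_elim
      case (elim \<omega>)
      then show ?case using do_trajectory_eq_response[OF elim, of x] by simp
    qed
    have "emeasure (total_effect D X s x Y t) B
        = emeasure (law D) {\<omega> \<in> space (law D). do_trajectory D X s x \<omega> (Y, t) \<in> B}"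
      unfolding total_effect_def using B measurable_do_trajectory
      by (subst emeasure_distr) (auto intro!: arg_cong[where f = "emeasure (law D)"])
    also have "\<dots> = emeasure (law D) {\<omega> \<in> space (law D). (?zW \<omega>, ?u \<omega>) \<in> T'}"
    proof (rule emeasure_eq_AE)
      show "AE \<omega> in law D. (\<omega> \<in> {\<omega> \<in> space (law D). do_trajectory D X s x \<omega> (Y, t) \<in> B}) =
          (\<omega> \<in> {\<omega> \<in> space (law D). (?zW \<omega>, ?u \<omega>) \<in> T'})"
        using response
      proof eventually_elim
        case (elim \<omega>)
        have "?zW \<omega> \<in> space ?VW" "?u \<omega> \<in> space ?N" by (auto simp: space_PiM)
        with measurable_space[OF upd] have "(?zW \<omega>)((X, s) := x) \<in> space ?VX" by blast
        with \<open>?zW \<omega> \<in> space ?VW\<close> \<open>?u \<omega> \<in> space ?N\<close> show ?case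
          using elim by (auto simp: T'_def T_def space_pair_measure)
      qed
      show "{\<omega> \<in> space (law D). do_trajectory D X s x \<omega> (Y, t) \<in> B} \<in> events"
        using B measurable_do_trajectory by measurable
      show "{\<omega> \<in> space (law D). (?zW \<omega>, ?u \<omega>) \<in> T'} \<in> events"
        using T' by measurable
    qed
    also have "\<dots> = (\<integral>\<^sup>+w. emeasure \<nu> (Pair w -` T') \<partial>distr (law D) ?VW ?zW)"
      unfolding \<nu>_def by (rule law_factorizes_disintegration[OF facW T'])
    also have "\<dots> = (\<integral>\<^sup>+w. \<kappa> B (w((X, s) := x)) \<partial>distr (law D) ?VW ?zW)"
    proof (rule nn_integral_cong)
      fix w assume "w \<in> space (distr (law D) ?VW ?zW)"
      then have "Pair w -` T' = Pair (w((X, s) := x)) -` T B"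
        by (auto simp: T'_def T_def space_pair_measure)
      then show "emeasure \<nu> (Pair w -` T') = \<kappa> B (w((X, s) := x))" by (simp add: \<kappa>_def)
    qed
    finally show "emeasure (total_effect D X s x Y t) B =
      (\<integral>\<^sup>+w. \<kappa> B (w((X, s) := x)) \<partial>distr (observational D) ?VW (\<lambda>z. restrict z adj))"
      unfolding distr_observational .
  qed
qed

end

section \<open>Identifiability\<close>

text \<open>
The conditional probabilities in the adjustment formula are fixed by the observational law up to null
sets of treatment and covariates jointly. Positivity turns these into null sets of covariates for
almost every treatment value, which the average over the covariates does not see.
\<close>

lemma total_effects_agree:
  fixes \<mu> :: "'v::finite \<Rightarrow> 'a::polish_space measure"
  assumes borel_values: "\<And>V. sets (\<mu> V) = sets borel"
    and sigma_finite_values: "\<And>V. sigma_finite_measure (\<mu> V)"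
    and D1: "effect_identification \<gamma>max \<gamma> \<mu> D1 E X Y s t"
    and D2: "effect_identification \<gamma>max \<gamma> \<mu> D2 E X Y s t"
    and same: "observational D1 = observational D2"
  shows "AE x in \<mu> X. total_effect D1 X s x Y t = total_effect D2 X s x Y t"
proof -
  let ?W = "adjustment_set \<gamma>max E X s"
  let ?i = "(X, s)"
  let ?VX = "PiM (insert ?i ?W) (\<lambda>_. borel :: 'a measure)"
  define P where "P = observational D1"
  define PX where "PX = distr P ?VX (\<lambda>z. restrict z (insert ?i ?W))"
  define PW where "PW = distr P (PiM ?W (\<lambda>_. borel)) (\<lambda>z. restrict z ?W)"
  interpret D1: effect_identification \<gamma>max \<gamma> \<mu> D1 E X Y s t by (rule D1)
  interpret D2: effect_identification \<gamma>max \<gamma> \<mu> D2 E X Y s t by (rule D2)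
  have P2: "observational D2 = P" unfolding P_def using same ..
  have pos: "positive_distribution \<mu> P"
    using D1.dscm unfolding is_dscm_def P_def by blast
  interpret PX: prob_space PX
    unfolding PX_def P_def D1.distr_observational by (rule D1.prob_space_distr) measurable
  from D1.backdoor_adjustment obtain \<kappa>1 where \<kappa>1: "\<And>B. B \<in> sets borel \<Longrightarrow>
     \<kappa>1 B \<in> borel_measurable ?VX \<and>
     (\<forall>C \<in> sets ?VX. emeasure P {z \<in> space P. restrict z (insert ?i ?W) \<in> C \<and> z (Y, t) \<in> B} =
        (\<integral>\<^sup>+ f. \<kappa>1 B f * indicator C f \<partial>PX)) \<and>
     (\<forall>x. emeasure (total_effect D1 X s x Y t) B = (\<integral>\<^sup>+ w. \<kappa>1 B (w(?i := x)) \<partial>PW))"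
    unfolding P_def[symmetric] PX_def[symmetric] PW_def[symmetric] by blast
  from D2.backdoor_adjustment obtain \<kappa>2 where \<kappa>2: "\<And>B. B \<in> sets borel \<Longrightarrow>
     \<kappa>2 B \<in> borel_measurable ?VX \<and>
     (\<forall>C \<in> sets ?VX. emeasure P {z \<in> space P. restrict z (insert ?i ?W) \<in> C \<and> z (Y, t) \<in> B} =
        (\<integral>\<^sup>+ f. \<kappa>2 B f * indicator C f \<partial>PX)) \<and>
     (\<forall>x. emeasure (total_effect D2 X s x Y t) B = (\<integral>\<^sup>+ w. \<kappa>2 B (w(?i := x)) \<partial>PW))"
    unfolding P2 PX_def[symmetric] PW_def[symmetric] by blast
  obtain G :: "'a set set" where G: "countable G" "Int_stable G" "UNIV \<in> G"
    "sets borel = sigma_sets UNIV G"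
    using countable_Int_stable_borel_generator by blast
  have kernels: "AE f in PX. \<kappa>1 B f = \<kappa>2 B f" if "B \<in> sets borel" for B
  proof (rule PX.density_unique)
    have sets_PX: "sets PX = sets ?VX" unfolding PX_def by simp
    show m: "\<kappa>1 B \<in> borel_measurable PX" "\<kappa>2 B \<in> borel_measurable PX"
      using \<kappa>1[OF that] \<kappa>2[OF that] by (simp_all add: PX_def)
    show "density PX (\<kappa>1 B) = density PX (\<kappa>2 B)"
    proof (rule measure_eqI)
      fix C assume "C \<in> sets (density PX (\<kappa>1 B))"
      then have C: "C \<in> sets PX" "C \<in> sets ?VX" using sets_PX by auto
      show "emeasure (density PX (\<kappa>1 B)) C = emeasure (density PX (\<kappa>2 B)) C"
        using \<kappa>1[OF that] \<kappa>2[OF that] C m by (simp add: emeasure_density)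
    qed simp
  qed
  have G_borel: "B \<in> sets borel" if "B \<in> G" for B using that G(4) by auto
  have "AE f in PX. \<forall>B\<in>G. \<kappa>1 B f = \<kappa>2 B f"
    using G(1) kernels G_borel by (simp add: AE_ball_countable)
  then have "AE x in \<mu> (fst ?i). AE w in PW. \<forall>B\<in>G. \<kappa>1 B (w(?i := x)) = \<kappa>2 B (w(?i := x))"
    unfolding PX_def PW_def
    by (intro positive_distribution_AE_insert[OF borel_values sigma_finite_values pos]
        finite_adjustment_set treatment_notin_adjustment_set)
  then show ?thesis
    unfolding fst_conv
  proof eventually_elim
    case (elim x)
    show ?case
    proof (rule measure_eqI_generator_eq[where E = G and \<Omega> = UNIV and A = "\<lambda>_. UNIV"])
      fix B assume B: "B \<in> G"
      have "(\<integral>\<^sup>+ w. \<kappa>1 B (w(?i := x)) \<partial>PW) = (\<integral>\<^sup>+ w. \<kappa>2 B (w(?i := x)) \<partial>PW)"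
        by (rule nn_integral_cong_AE) (use elim B in \<open>auto elim: eventually_mono\<close>)
      then show "emeasure (total_effect D1 X s x Y t) B = emeasure (total_effect D2 X s x Y t) B"
        using \<kappa>1[OF G_borel[OF B]] \<kappa>2[OF G_borel[OF B]] by simp
    next
      interpret effect: prob_space "total_effect D1 X s x Y t"
        by (rule D1.prob_space_total_effect)
      show "emeasure (total_effect D1 X s x Y t) UNIV \<noteq> \<infinity>" for n :: nat
        by (simp add: effect.emeasure_eq_measure)
    qed (use G in \<open>auto simp: total_effect_def\<close>)
  qed
qed

text \<open>
A formula in the observational law is any functional of it. Once models with equal observational laws
have almost everywhere equal effects, one may read off the effect from an arbitrary model chosen for
the given law.
\<close>

lemma identifiable_if_determined:
  assumes "\<And>D1 D2 :: ('v, 'a::topological_space) dscm.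
      is_dscm \<gamma>max \<mu> D1 \<Longrightarrow> ftcg_of D1 \<in> candidate_ftcgs \<gamma>max E \<Longrightarrow>
      is_dscm \<gamma>max \<mu> D2 \<Longrightarrow> ftcg_of D2 \<in> candidate_ftcgs \<gamma>max E \<Longrightarrow>
      observational D1 = observational D2 \<Longrightarrow>
      AE x in \<mu> X. total_effect D1 X (t - int \<gamma>) x Y t = total_effect D2 X (t - int \<gamma>) x Y t"
  shows "identifiable \<gamma>max \<mu> E X Y \<gamma> t"
proof -
  let ?model = "\<lambda>P D. is_dscm \<gamma>max \<mu> D \<and> ftcg_of D \<in> candidate_ftcgs \<gamma>max E \<and> observational D = P"
  show ?thesis
    unfolding identifiable_def
  proof (intro exI[of _ "\<lambda>P x. total_effect (SOME D. ?model P D) X (t - int \<gamma>) x Y t"] allI impI)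
    fix D :: "('v, 'a) dscm"
    assume D: "is_dscm \<gamma>max \<mu> D \<and> ftcg_of D \<in> candidate_ftcgs \<gamma>max E"
    then have "?model (observational D) (SOME D'. ?model (observational D) D')"
      by (intro someI[of "?model (observational D)" D]) simp
    then show "AE x in \<mu> X. total_effect D X (t - int \<gamma>) x Y t =
        total_effect (SOME D'. ?model (observational D) D') X (t - int \<gamma>) x Y t"
      using D by (intro assms) auto
  qed
qed

theorem theorem2:
  fixes \<gamma>max \<gamma> :: nat and t :: int
    and \<mu> :: "'v::finite \<Rightarrow> 'a::polish_space measure"
    and D :: "('v, 'a) dscm"
    and Gs :: "'v scg" and X Y :: 'v
  assumes borel_values: "\<And>V. sets (\<mu> V) = sets borel"
    and sigma_finite_values: "\<And>V. sigma_finite_measure (\<mu> V)"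
    and true_model: "is_dscm \<gamma>max \<mu> D"
    and scg: "Gs = scg_of \<gamma>max (ftcg_of D)"
    and distinct: "X \<noteq> Y"
    and condition:
      "X \<notin> Anc Y Gs \<or>
       (X \<in> Anc Y Gs \<and>
        \<not> (\<gamma> \<noteq> 0 \<and> Cycles_gt X (remove_vertex Gs Y) \<noteq> {}) \<and>
        \<not> (\<exists>\<pi>. backdoor_path Gs X \<pi> Y \<and> sigma_active Gs \<pi> \<and>
               inner_vertices \<pi> \<subseteq> Desc X Gs \<and>
               (length \<pi> > 2 \<or>
                (length \<pi> = 2 \<and> \<gamma> \<noteq> 1) \<or>
                (length \<pi> = 2 \<and> \<gamma> = 1 \<and> Cycles Y Gs - two_cycle X Y \<noteq> {}))))"
  shows "identifiable \<gamma>max \<mu> Gs X Y \<gamma> t"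
proof (rule identifiable_if_determined)
  have cond: "effect_identification_condition Gs X Y \<gamma>"
    unfolding effect_identification_condition_def by (rule condition)
  fix D1 D2 :: "('v, 'a) dscm"
  assume "is_dscm \<gamma>max \<mu> D1" "ftcg_of D1 \<in> candidate_ftcgs \<gamma>max Gs"
    "is_dscm \<gamma>max \<mu> D2" "ftcg_of D2 \<in> candidate_ftcgs \<gamma>max Gs"
    and same: "observational D1 = observational D2"
  then have "effect_identification \<gamma>max \<gamma> \<mu> D1 Gs X Y (t - int \<gamma>) t"
    "effect_identification \<gamma>max \<gamma> \<mu> D2 Gs X Y (t - int \<gamma>) t"
    by unfold_locales (use distinct cond in auto)
  then show "AE x in \<mu> X. total_effect D1 X (t - int \<gamma>) x Y t = total_effect D2 X (t - int \<gamma>) x Y t"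
    by (rule total_effects_agree[OF borel_values sigma_finite_values _ _ same])
qed

end
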